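(* Let $A=\Bbbk(\omega,N)$, let $R$ be the subalgebra of $A$ generated by $x$, and for $s\in S$, $0\le t\le N-1$ put $N_{s,t}:=e_sx^tR$. Then the $N_{s,t}$ ($s\in S$, $0\le t\le N-1$) form an irredundant set of representatives of $\mathcal{L}_{\mathrm{in}}(A_A)$ (that is, every indecomposable right ideal of $A$ is isomorphic, as a right $A$-module, to exactly one of the $N_{s,t}$, each of which is itself an indecomposable right ideal), and $$\mathcal{L}_{\mathrm{in}}(A_A)=\{(1+rx)N_{s,t}\mid r\in R,\ s\in S,\ 0\le t\le N-1\}.$$
   Context: $\Bbbk$ is a field. Let $N\ge 2$ be an integer, $S$ a finite set of cardinality at least $N$, and $\omega$ a permutation of $S$. $\Bbbk(\omega,N)$ denotes the (unital associative) $\Bbbk$-algebra generated by $\{e_s, x\mid s\in S\}$ with relations, for all $s,t\in S$, $$e_se_t=\delta_{s,t}e_t,\qquad 1=\sum_{s\in S}e_s,\qquad x^N=0,\qquad e_sx=xe_{\omega(s)}.$$ It has $\Bbbk$-basis $\{x^ne_s\mid 0\le n\le N-1,\ s\in S\}=\{e_tx^n\mid 0\le n\le N-1,\ t\in S\}$. The subalgebra $R$ generated by $x$ is $\Bbbk[x\mid x^N=0]$. $\mathcal{L}_{\mathrm{in}}(A_A)$ denotes the set of right ideals of $A$ that are indecomposable as right $A$-modules (in particular non-zero). *)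

theory Defs
  imports
    "HOL-Library.Poly_Mapping"
    "HOL-Combinatorics.Permutations"
    "HOL-Algebra.QuotRing"
    "HOL-Algebra.Generated_Rings"
begin

section \<open>Free algebras over a field\<close>

text \<open>
  The free monoid is written additively, because the convolution product of
  \<^typ>\<open>'w \<Rightarrow>\<^sub>0 'k\<close> is the monoid algebra product only for the class
  \<^class>\<open>monoid_add\<close>.  Thus \<open>'g fword \<Rightarrow>\<^sub>0 'k\<close> is the free algebra over \<open>'k\<close>
  on all of \<open>'g\<close>.
\<close>

datatype 'g fword = FWord (letters: "'g list")

instantiation fword :: (type) monoid_add
begin

definition zero_fword :: "'a fword" where
  "0 = FWord []"

definition plus_fword :: "'a fword \<Rightarrow> 'a fword \<Rightarrow> 'a fword" where
  "u + v = FWord (letters u @ letters v)"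

instance
  by standard (simp_all add: zero_fword_def plus_fword_def)

end

lemma letters_zero [simp]: "letters 0 = []"
  by (simp add: zero_fword_def)

lemma letters_plus [simp]: "letters (u + v) = letters u @ letters v"
  by (simp add: plus_fword_def)

text \<open>The free algebra on a set \<open>G\<close> of generators, as a ring with explicit carrier.\<close>

definition free_alg :: "'g set \<Rightarrow> ('g fword \<Rightarrow>\<^sub>0 'k::field) ring" where
  "free_alg G =
    \<lparr>carrier = {p. \<forall>w \<in> Poly_Mapping.keys p. set (letters w) \<subseteq> G},
     mult = (*), one = 1, zero = 0, add = (+)\<rparr>"

definition fgen :: "'g \<Rightarrow> ('g fword \<Rightarrow>\<^sub>0 'k::field)" where
  "fgen g = Poly_Mapping.single (FWord [g]) 1"

definition fconst :: "'k \<Rightarrow> ('g fword \<Rightarrow>\<^sub>0 'k::field)" where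
  "fconst c = Poly_Mapping.single 0 c"

lemma free_alg_simps [simp]:
  "mult (free_alg G) = (*)" "one (free_alg G) = 1"
  "zero (free_alg G) = 0" "add (free_alg G) = (+)"
  by (simp_all add: free_alg_def)

lemma free_alg_carrier_iff:
  "p \<in> carrier (free_alg G) \<longleftrightarrow> (\<forall>w \<in> Poly_Mapping.keys p. set (letters w) \<subseteq> G)"
  by (simp add: free_alg_def)

lemma free_alg_zero: "0 \<in> carrier (free_alg G)"
  by (simp add: free_alg_carrier_iff)

lemma free_alg_add:
  assumes "p \<in> carrier (free_alg G)" "q \<in> carrier (free_alg G)"
  shows "p + q \<in> carrier (free_alg G)"
  using assms Poly_Mapping.keys_add[of p q] unfolding free_alg_carrier_iff by blast

lemma free_alg_uminus:
  assumes "p \<in> carrier (free_alg G)"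
  shows "- p \<in> carrier (free_alg G)"
  using assms by (simp add: free_alg_carrier_iff)

lemma free_alg_diff:
  assumes "p \<in> carrier (free_alg G)" "q \<in> carrier (free_alg G)"
  shows "p - q \<in> carrier (free_alg G)"
  using free_alg_add[OF assms(1) free_alg_uminus[OF assms(2)]] by simp

lemma free_alg_mult:
  assumes "p \<in> carrier (free_alg G)" "q \<in> carrier (free_alg G)"
  shows "p * q \<in> carrier (free_alg G)"
  unfolding free_alg_carrier_iff
proof
  fix w assume "w \<in> Poly_Mapping.keys (p * q)"
  then obtain u v where "u \<in> Poly_Mapping.keys p" "v \<in> Poly_Mapping.keys q" "w = u + v"
    using Poly_Mapping.keys_mult[of p q] by blast
  then show "set (letters w) \<subseteq> G"
    using assms by (simp add: free_alg_carrier_iff)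
qed

lemma free_alg_const: "fconst c \<in> carrier (free_alg G)"
  by (simp add: free_alg_carrier_iff fconst_def)

lemma fconst_one: "fconst 1 = 1"
  by (simp add: fconst_def)

lemma free_alg_one: "1 \<in> carrier (free_alg G)"
  using free_alg_const[of 1 G] by (simp add: fconst_one)

lemma free_alg_gen: "g \<in> G \<Longrightarrow> fgen g \<in> carrier (free_alg G)"
  by (simp add: free_alg_carrier_iff fgen_def)

lemma free_alg_power: "p \<in> carrier (free_alg G) \<Longrightarrow> p ^ n \<in> carrier (free_alg G)"
  by (induction n) (simp_all add: free_alg_one free_alg_mult)

lemma free_alg_sum:
  "(\<And>i. i \<in> I \<Longrightarrow> f i \<in> carrier (free_alg G)) \<Longrightarrow> sum f I \<in> carrier (free_alg G)"
  by (induction I rule: infinite_finite_induct) (simp_all add: free_alg_zero free_alg_add)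

lemma free_alg_ring: "ring (free_alg G :: ('g fword \<Rightarrow>\<^sub>0 'k::field) ring)"
proof (rule ringI)
  show "abelian_group (free_alg G :: ('g fword \<Rightarrow>\<^sub>0 'k) ring)"
  proof (rule abelian_groupI)
    fix p :: "'g fword \<Rightarrow>\<^sub>0 'k" assume "p \<in> carrier (free_alg G)"
    then show "\<exists>y\<in>carrier (free_alg G). y \<oplus>\<^bsub>free_alg G\<^esub> p = \<zero>\<^bsub>free_alg G\<^esub>"
      by (intro bexI[of _ "- p"]) (simp_all add: free_alg_uminus)
  qed (simp_all add: free_alg_zero free_alg_add ac_simps)
  show "Group.monoid (free_alg G :: ('g fword \<Rightarrow>\<^sub>0 'k) ring)"
    by (rule Group.monoidI) (simp_all add: free_alg_one free_alg_mult mult.assoc)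
qed (simp_all add: algebra_simps)


section \<open>The algebra presented by the permutation \<open>\<omega>\<close> and the nilpotency degree \<open>N\<close>\<close>

datatype 's kgen = Gen_e 's | Gen_x

definition kw_gens :: "'s set \<Rightarrow> 's kgen set" where
  "kw_gens S = insert Gen_x (Gen_e ` S)"

definition kw_rels :: "'s set \<Rightarrow> ('s \<Rightarrow> 's) \<Rightarrow> nat \<Rightarrow> ('s kgen fword \<Rightarrow>\<^sub>0 'k::field) set" where
  "kw_rels S \<omega> N =
     {fgen (Gen_e s) * fgen (Gen_e t) - (if s = t then fgen (Gen_e t) else 0) | s t. s \<in> S \<and> t \<in> S}
   \<union> {1 - (\<Sum>s\<in>S. fgen (Gen_e s))}
   \<union> {fgen Gen_x ^ N}
   \<union> {fgen (Gen_e s) * fgen Gen_x - fgen Gen_x * fgen (Gen_e (\<omega> s)) | s. s \<in> S}"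

definition kw_ideal :: "'s set \<Rightarrow> ('s \<Rightarrow> 's) \<Rightarrow> nat \<Rightarrow> ('s kgen fword \<Rightarrow>\<^sub>0 'k::field) set" where
  "kw_ideal S \<omega> N = Idl\<^bsub>free_alg (kw_gens S)\<^esub> (kw_rels S \<omega> N)"

definition kw_alg :: "'s set \<Rightarrow> ('s \<Rightarrow> 's) \<Rightarrow> nat \<Rightarrow> ('s kgen fword \<Rightarrow>\<^sub>0 'k::field) set ring" where
  "kw_alg S \<omega> N = free_alg (kw_gens S) Quot kw_ideal S \<omega> N"

definition kw_class ::
    "'s set \<Rightarrow> ('s \<Rightarrow> 's) \<Rightarrow> nat \<Rightarrow> ('s kgen fword \<Rightarrow>\<^sub>0 'k::field) \<Rightarrow> ('s kgen fword \<Rightarrow>\<^sub>0 'k) set" where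
  "kw_class S \<omega> N p = kw_ideal S \<omega> N +>\<^bsub>free_alg (kw_gens S)\<^esub> p"

definition kw_e :: "'s set \<Rightarrow> ('s \<Rightarrow> 's) \<Rightarrow> nat \<Rightarrow> 's \<Rightarrow> ('s kgen fword \<Rightarrow>\<^sub>0 'k::field) set" where
  "kw_e S \<omega> N s = kw_class S \<omega> N (fgen (Gen_e s))"

definition kw_x :: "'s set \<Rightarrow> ('s \<Rightarrow> 's) \<Rightarrow> nat \<Rightarrow> ('s kgen fword \<Rightarrow>\<^sub>0 'k::field) set" where
  "kw_x S \<omega> N = kw_class S \<omega> N (fgen Gen_x)"

text \<open>The image of the base field in the algebra.\<close>

definition kw_scalars :: "'s set \<Rightarrow> ('s \<Rightarrow> 's) \<Rightarrow> nat \<Rightarrow> ('s kgen fword \<Rightarrow>\<^sub>0 'k::field) set set" where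
  "kw_scalars S \<omega> N = range (\<lambda>c. kw_class S \<omega> N (fconst c))"

text \<open>
  A unital subalgebra is a subring containing the scalars, so the subalgebra
  generated by \<open>x\<close> is the subring generated by the scalars together with \<open>x\<close>.
\<close>

definition kw_R :: "'s set \<Rightarrow> ('s \<Rightarrow> 's) \<Rightarrow> nat \<Rightarrow> ('s kgen fword \<Rightarrow>\<^sub>0 'k::field) set set" where
  "kw_R S \<omega> N = generate_ring (kw_alg S \<omega> N) (kw_scalars S \<omega> N \<union> {kw_x S \<omega> N})"

lemma kw_rels_carrier:
  assumes "\<And>s. s \<in> S \<Longrightarrow> \<omega> s \<in> S"
  shows "kw_rels S \<omega> N \<subseteq> carrier (free_alg (kw_gens S))"
proof -
  have e: "fgen (Gen_e s) \<in> carrier (free_alg (kw_gens S))" if "s \<in> S" for s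
    using that by (intro free_alg_gen) (simp add: kw_gens_def)
  have x: "fgen Gen_x \<in> carrier (free_alg (kw_gens S))"
    by (intro free_alg_gen) (simp add: kw_gens_def)
  show ?thesis
    unfolding kw_rels_def using assms
    by (auto intro!: e x free_alg_mult free_alg_diff free_alg_power free_alg_sum
        free_alg_one free_alg_zero)
qed

lemma kw_ideal_ideal:
  assumes "\<omega> permutes S"
  shows "ideal (kw_ideal S \<omega> N :: ('s kgen fword \<Rightarrow>\<^sub>0 'k::field) set) (free_alg (kw_gens S))"
  unfolding kw_ideal_def
  by (intro ring.genideal_ideal free_alg_ring kw_rels_carrier)
     (use permutes_in_image[OF assms] in simp)

lemma kw_alg_ring:
  assumes "\<omega> permutes S"
  shows "ring (kw_alg S \<omega> N :: ('s kgen fword \<Rightarrow>\<^sub>0 'k::field) set ring)"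
  unfolding kw_alg_def by (rule ideal.quotient_is_ring[OF kw_ideal_ideal[OF assms]])


section \<open>Right ideals as right modules\<close>

locale right_ideal = additive_subgroup I R + ring R for I and R (structure) +
  assumes I_r_closed: "\<lbrakk>a \<in> I; b \<in> carrier R\<rbrakk> \<Longrightarrow> a \<otimes> b \<in> I"

text \<open>
  The submodules of a right ideal \<open>I\<close>, regarded as a right module, are exactly the right
  ideals contained in \<open>I\<close>; in a decomposition \<open>I = J + K\<close> the containment is automatic.
\<close>

definition indecomposable_right_ideal :: "('a, 'm) ring_scheme \<Rightarrow> 'a set \<Rightarrow> bool" where
  "indecomposable_right_ideal A I \<longleftrightarrow>
     right_ideal I A \<and> I \<noteq> {\<zero>\<^bsub>A\<^esub>} \<and>
     (\<forall>J K. right_ideal J A \<and> right_ideal K A \<and> J <+>\<^bsub>A\<^esub> K = I \<and> J \<inter> K = {\<zero>\<^bsub>A\<^esub>}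
        \<longrightarrow> J = {\<zero>\<^bsub>A\<^esub>} \<or> K = {\<zero>\<^bsub>A\<^esub>})"

definition L_in :: "('a, 'm) ring_scheme \<Rightarrow> 'a set set" where
  "L_in A = {I. indecomposable_right_ideal A I}"

definition right_module_hom :: "('a, 'm) ring_scheme \<Rightarrow> 'a set \<Rightarrow> 'a set \<Rightarrow> ('a \<Rightarrow> 'a) set" where
  "right_module_hom A I J =
     {f \<in> I \<rightarrow> J. (\<forall>u\<in>I. \<forall>v\<in>I. f (u \<oplus>\<^bsub>A\<^esub> v) = f u \<oplus>\<^bsub>A\<^esub> f v) \<and>
                  (\<forall>u\<in>I. \<forall>a\<in>carrier A. f (u \<otimes>\<^bsub>A\<^esub> a) = f u \<otimes>\<^bsub>A\<^esub> a)}"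

definition right_module_isomorphic :: "('a, 'm) ring_scheme \<Rightarrow> 'a set \<Rightarrow> 'a set \<Rightarrow> bool" where
  "right_module_isomorphic A I J \<longleftrightarrow> (\<exists>f \<in> right_module_hom A I J. bij_betw f I J)"

end

theory Submission
  imports Defs "HOL-Combinatorics.Cycles"
begin

text \<open>
Write \<open>N\<^sub>s\<^sub>,\<^sub>t = e\<^sub>s x\<^sup>t R\<close>.  The relations let every element of \<open>e\<^sub>u R e\<^sub>v\<close> be
rewritten both as an element of \<open>R e\<^sub>v\<close> and as one of \<open>e\<^sub>u R\<close> (lemma \<open>R_corner\<close>), so
\<open>e\<^sub>u A = e\<^sub>u R\<close> and \<open>A e\<^sub>v = R e\<^sub>v\<close>.  Since \<open>R\<close> is a truncated polynomial ring, each of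
its nonzero elements is \<open>c (1 + r x) x\<^sup>m\<close> with \<open>c\<close> a nonzero scalar and \<open>1 + r x\<close>
invertible in \<open>R\<close>.  Everything else follows from these facts.

Indecomposability of \<open>h N\<^sub>s\<^sub>,\<^sub>t\<close> for a unit \<open>h\<close> of \<open>R\<close>: a nonzero element of \<open>e\<^sub>s R\<close> can be
multiplied on the right by an element of \<open>R\<close> to give \<open>e\<^sub>s x\<^bsup>N-1\<^esup>\<close>.  So any two nonzero
right ideals inside \<open>h N\<^sub>s\<^sub>,\<^sub>t\<close> share the element \<open>h e\<^sub>s x\<^bsup>N-1\<^esup>\<close> and cannot be complements.

Conversely let \<open>I\<close> be an indecomposable right ideal, and let \<open>t\<close> be the least exponent for
which some \<open>u = h x\<^sup>t e\<^sub>v\<close> with \<open>h = 1 + r x\<close> lies in \<open>I\<close>.  Minimality gives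
\<open>I \<subseteq> x\<^sup>t A\<close>.  Choose \<open>s\<close> with \<open>x\<^sup>t e\<^sub>v = e\<^sub>s x\<^sup>t\<close>; then \<open>u A = h N\<^sub>s\<^sub>,\<^sub>t \<subseteq> I\<close>.  The
idempotent \<open>f = h e\<^sub>s h\<^sup>-\<^sup>1\<close> maps \<open>x\<^sup>t A\<close>, hence \<open>I\<close>, into \<open>h N\<^sub>s\<^sub>,\<^sub>t \<subseteq> I\<close>, so
\<open>I = f I \<oplus> (1 - f) I\<close>.  As \<open>f u = u \<noteq> 0\<close>, indecomposability forces \<open>I = f I = h N\<^sub>s\<^sub>,\<^sub>t\<close>
(lemma \<open>indecomposable_is_translate\<close>).

No two of the \<open>N\<^sub>s\<^sub>,\<^sub>t\<close> are isomorphic: \<open>t\<close> is determined by the power of \<open>x\<close> that annihilates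
\<open>N\<^sub>s\<^sub>,\<^sub>t\<close>, and \<open>s\<close> by the idempotent that fixes its socle, spanned by \<open>e\<^sub>s x\<^bsup>N-1\<^esup>\<close>
(lemma \<open>path_module_embedding\<close>).

The argument uses the presentation only through the relations and the fact that
\<open>e\<^sub>s x\<^bsup>N-1\<^esup> \<noteq> 0\<close>.  It is therefore carried out in the locale \<open>permutation_algebra\<close>, and
the nonvanishing is obtained for the presented algebra from an explicit action of the free
algebra on functions of pairs \<open>(m, v)\<close>, in which the ideal of relations produces only functions
that vanish for \<open>m < N\<close> and \<open>v \<in> S\<close>.
\<close>

section \<open>Indecomposable right ideals of a ring\<close>

context ring
begin

lemma generated_commute:
  assumes "H \<subseteq> carrier R" "a \<in> carrier R"
    and "\<And>h. h \<in> H \<Longrightarrow> h \<otimes> a = a \<otimes> h" and "r \<in> generate_ring R H"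
  shows "r \<otimes> a = a \<otimes> r"
  using assms(4)
proof (induction rule: generate_ring.induct)
  case (a_inv h)
  then show ?case
    using assms(2) generate_ring_in_carrier[OF assms(1)] by (simp add: l_minus r_minus)
next
  case (eng_add h1 h2)
  then show ?case
    using assms(2) generate_ring_in_carrier[OF assms(1)] by (simp add: l_distr r_distr)
next
  case (eng_mult h1 h2)
  then have "h1 \<in> carrier R" "h2 \<in> carrier R"
    using generate_ring_in_carrier[OF assms(1)] by auto
  with eng_mult show ?case
    using assms(2) by (metis m_assoc)
qed (use assms in auto)

lemma right_idealI:
  assumes "I \<subseteq> carrier R" "\<zero> \<in> I" "\<And>a b. a \<in> I \<Longrightarrow> b \<in> I \<Longrightarrow> a \<oplus> b \<in> I"
    and "\<And>a b. a \<in> I \<Longrightarrow> b \<in> carrier R \<Longrightarrow> a \<otimes> b \<in> I"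
  shows "right_ideal I R"
proof -
  have "\<ominus> a \<in> I" if "a \<in> I" for a
  proof -
    have "\<ominus> a = a \<otimes> \<ominus> \<one>" using that assms(1) by (auto simp: r_minus)
    then show ?thesis using assms(4)[OF that] by simp
  qed
  then have "subgroup I (add_monoid R)"
    using assms by (intro add.subgroupI) auto
  then show ?thesis
    using assms by (intro right_ideal.intro right_ideal_axioms.intro additive_subgroup.intro ring_axioms) auto
qed

text \<open>An idempotent \<open>f\<close> with \<open>f I \<subseteq> I\<close> splits \<open>I\<close> into the right ideals on which it acts as
the identity and as zero; here \<open>u\<close> witnesses that the former is nonzero.\<close>

lemma indecomposable_idempotent:
  assumes I: "indecomposable_right_ideal R I"
    and f: "f \<in> carrier R" "f \<otimes> f = f" "\<And>y. y \<in> I \<Longrightarrow> f \<otimes> y \<in> I"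
    and u: "u \<in> I" "f \<otimes> u \<noteq> \<zero>" and y: "y \<in> I"
  shows "f \<otimes> y = y"
proof -
  interpret I: right_ideal I R
    using I by (simp add: indecomposable_right_ideal_def)
  note [simp] = I.a_Hcarr
  have sub: "a \<ominus> b \<in> I" if "a \<in> I" "b \<in> I" for a b
    using that by (simp add: minus_eq)
  have f_mult: "f \<otimes> (a \<otimes> b) = f \<otimes> a \<otimes> b" if "a \<in> I" "b \<in> carrier R" for a b
    using that f(1) by (simp add: m_assoc)
  define J where "J = {y \<in> I. f \<otimes> y = y}"
  define K where "K = {y \<in> I. f \<otimes> y = \<zero>}"
  have J: "right_ideal J R"
    by (rule right_idealI) (use f(1) in \<open>auto simp: J_def r_distr I.I_r_closed f_mult\<close>)
  have K: "right_ideal K R"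
    by (rule right_idealI) (use f(1) in \<open>auto simp: K_def r_distr I.I_r_closed f_mult\<close>)
  have "I \<subseteq> J <+> K"
  proof
    fix y assume y: "y \<in> I"
    have ff: "f \<otimes> (f \<otimes> y) = f \<otimes> y"
      using f y by (simp add: m_assoc[symmetric])
    have "f \<otimes> (y \<ominus> f \<otimes> y) = \<zero>"
      using f y ff by (simp add: minus_eq r_distr r_minus r_neg)
    then have "f \<otimes> y \<in> J" "y \<ominus> f \<otimes> y \<in> K"
      using y f ff sub by (auto simp: J_def K_def)
    moreover have "y = f \<otimes> y \<oplus> (y \<ominus> f \<otimes> y)"
      using y f by (simp add: minus_eq a_lcomm[of "f \<otimes> y"] r_neg)
    ultimately show "y \<in> J <+> K"
      unfolding set_add_def set_mult_def by auto
  qed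
  then have "J <+> K = I"
    unfolding set_add_def set_mult_def by (auto simp: J_def K_def)
  moreover have "J \<inter> K = {\<zero>}"
    using f(1) by (auto simp: J_def K_def)
  ultimately have "J = {\<zero>} \<or> K = {\<zero>}"
    using I J K unfolding indecomposable_right_ideal_def by blast
  moreover have "f \<otimes> u \<in> J"
    using f u by (simp add: J_def m_assoc[symmetric])
  ultimately have "K = {\<zero>}" using u by auto
  moreover have "y \<ominus> f \<otimes> y \<in> K"
    using f y sub[of y "f \<otimes> y"] by (simp add: K_def minus_eq r_distr r_minus m_assoc[symmetric] r_neg)
  ultimately have "y \<ominus> f \<otimes> y = \<zero>" by simp
  then show ?thesis using f y by simp
qed

text \<open>Two nonzero right ideals below \<open>I\<close> would both contain \<open>z\<close>, so their sum is not direct.\<close>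

lemma indecomposable_uniform:
  assumes I: "right_ideal I R" and z: "z \<noteq> \<zero>" "z \<in> I"
    and "\<And>J. right_ideal J R \<Longrightarrow> J \<subseteq> I \<Longrightarrow> J \<noteq> {\<zero>} \<Longrightarrow> z \<in> J"
  shows "indecomposable_right_ideal R I"
proof -
  have "J = {\<zero>} \<or> K = {\<zero>}"
    if JK: "right_ideal J R" "right_ideal K R" "J <+> K = I" "J \<inter> K = {\<zero>}" for J K
  proof (rule ccontr)
    assume ne: "\<not> (J = {\<zero>} \<or> K = {\<zero>})"
    interpret J: right_ideal J R by fact
    interpret K: right_ideal K R by fact
    have sum: "a \<oplus> b \<in> I" if "a \<in> J" "b \<in> K" for a b
      using that JK(3) unfolding set_add_def set_mult_def by auto
    have "J \<subseteq> I"
      using sum[OF _ K.zero_closed] J.a_Hcarr by auto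
    moreover have "K \<subseteq> I"
      using sum[OF J.zero_closed] K.a_Hcarr by auto
    ultimately have "z \<in> J \<inter> K"
      using assms(4)[of J] assms(4)[of K] JK ne by blast
    then show False using z JK by auto
  qed
  then show ?thesis
    using I z unfolding indecomposable_right_ideal_def by auto
qed

text \<open>Two representatives \<open>J\<close> and \<open>K\<close> of the same isomorphism class embed in each other; this is
all that the comparison of the representatives needs.\<close>

lemma right_module_isomorphic_embedding:
  assumes "right_ideal I R" "right_module_isomorphic R I J" "right_module_isomorphic R I K"
  obtains f where "f \<in> right_module_hom R J K" "inj_on f J"
proof -
  interpret I: right_ideal I R by fact
  obtain p where p: "p \<in> right_module_hom R I J" "bij_betw p I J"
    using assms by (auto simp: right_module_isomorphic_def)
  obtain q where q: "q \<in> right_module_hom R I K" "bij_betw q I K"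
    using assms by (auto simp: right_module_isomorphic_def)
  define p' where "p' = inv_into I p"
  have p': "bij_betw p' J I" and pp: "\<And>u. u \<in> J \<Longrightarrow> p (p' u) = u" and p'p: "\<And>a. a \<in> I \<Longrightarrow> p' (p a) = a"
    unfolding p'_def using p(2)
    by (auto simp: bij_betw_inv_into bij_betw_inv_into_right bij_betw_inv_into_left)
  have p'I: "p' u \<in> I" if "u \<in> J" for u
    using p' that by (auto simp: bij_betw_def)
  have add: "p' (u \<oplus> v) = p' u \<oplus> p' v" if "u \<in> J" "v \<in> J" for u v
  proof -
    have "p (p' u \<oplus> p' v) = u \<oplus> v"
      using p(1) that p'I pp by (simp add: right_module_hom_def)
    then show ?thesis using p'p[of "p' u \<oplus> p' v"] that p'I by simp
  qed
  have mult: "p' (u \<otimes> a) = p' u \<otimes> a" if "u \<in> J" "a \<in> carrier R" for u a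
  proof -
    have "p (p' u \<otimes> a) = u \<otimes> a"
      using p(1) that p'I pp by (simp add: right_module_hom_def)
    then show ?thesis using p'p[of "p' u \<otimes> a"] that p'I by (simp add: I.I_r_closed)
  qed
  show ?thesis
  proof (rule that[of "q \<circ> p'"])
    show "q \<circ> p' \<in> right_module_hom R J K"
      using q(1) p'I by (auto simp: right_module_hom_def add mult)
    show "inj_on (q \<circ> p') J"
      using bij_betw_trans[OF p' q(2)] by (rule bij_betw_imp_inj_on)
  qed
qed

end

section \<open>The relations of the algebra and its nilpotent subalgebra\<close>

text \<open>The field enters through the map \<open>scal\<close> onto the scalars of the algebra.  The condition
\<open>socle_nonzero\<close> stands in for the linear independence of the elements \<open>e\<^sub>s x\<^sup>n\<close>: it keeps
the algebra from being a proper quotient of the presented one.\<close>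

locale permutation_algebra = ring A for A (structure) +
  fixes scal :: "'k::field \<Rightarrow> 'a" and S :: "'s set" and \<omega> :: "'s \<Rightarrow> 's" and N :: nat
    and e :: "'s \<Rightarrow> 'a" and x :: 'a
  assumes scal_closed [simp]: "scal c \<in> carrier A"
    and scal_add: "scal (c + d) = scal c \<oplus> scal d"
    and scal_mult: "scal (c * d) = scal c \<otimes> scal d"
    and scal_one: "scal 1 = \<one>"
    and scal_central: "a \<in> carrier A \<Longrightarrow> scal c \<otimes> a = a \<otimes> scal c"
    and finite_S: "finite S"
    and perm: "\<omega> permutes S"
    and N_pos: "1 \<le> N"
    and e_closed [simp]: "s \<in> S \<Longrightarrow> e s \<in> carrier A"
    and x_closed [simp]: "x \<in> carrier A"
    and e_e: "s \<in> S \<Longrightarrow> t \<in> S \<Longrightarrow> e s \<otimes> e t = (if s = t then e t else \<zero>)"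
    and sum_e: "finsum A e S = \<one>"
    and x_nilpotent: "x [^] N = \<zero>"
    and e_x: "s \<in> S \<Longrightarrow> e s \<otimes> x = x \<otimes> e (\<omega> s)"
    and generated: "generate_ring A (range scal \<union> {x} \<union> e ` S) = carrier A"
    and socle_nonzero: "s \<in> S \<Longrightarrow> e s \<otimes> x [^] (N - 1) \<noteq> \<zero>"
begin

definition R :: "'a set" where
  "R = generate_ring A (range scal \<union> {x})"

definition path_module :: "'s \<Rightarrow> nat \<Rightarrow> 'a set" where
  "path_module s t = {e s \<otimes> x [^] t \<otimes> r | r. r \<in> R}"

lemma scal_zero: "scal 0 = \<zero>"
  using scal_add[of 0 0] by (simp add: add.l_cancel_one)

lemma scal_minus: "scal (- c) = \<ominus> scal c"
  using scal_add[of "- c" c] by (simp add: scal_zero minus_equality)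

lemma R_closed [simp]: "r \<in> R \<Longrightarrow> r \<in> carrier A"
  unfolding R_def by (rule generate_ring_in_carrier) auto

lemma R_scal [simp]: "scal c \<in> R"
  and R_x [simp]: "x \<in> R"
  and R_one [simp]: "\<one> \<in> R"
  and R_minus [simp]: "r \<in> R \<Longrightarrow> \<ominus> r \<in> R"
  and R_add [simp]: "r \<in> R \<Longrightarrow> r' \<in> R \<Longrightarrow> r \<oplus> r' \<in> R"
  and R_mult [simp]: "r \<in> R \<Longrightarrow> r' \<in> R \<Longrightarrow> r \<otimes> r' \<in> R"
  unfolding R_def by (auto intro: generate_ring.intros)

lemma R_zero [simp]: "\<zero> \<in> R"
  using R_scal[of 0] by (simp only: scal_zero)

lemma R_pow [simp]: "r \<in> R \<Longrightarrow> r [^] (n::nat) \<in> R"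
  by (induction n) auto

lemma R_commute:
  assumes "r \<in> R" "r' \<in> R"
  shows "r \<otimes> r' = r' \<otimes> r"
proof -
  have x: "x \<otimes> a = a \<otimes> x" if "a \<in> R" for a
    using generated_commute[of "range scal \<union> {x}" x a] that scal_central[of x]
    unfolding R_def[symmetric] by force
  show ?thesis
    using generated_commute[of "range scal \<union> {x}" r' r] assms x scal_central[of r']
    unfolding R_def[symmetric] by force
qed

lemma x_pow_zero: "N \<le> n \<Longrightarrow> x [^] n = \<zero>"
  using nat_pow_mult[of x N "n - N"] by (simp add: x_nilpotent)

text \<open>Splitting off the constant term is the only way in which elements of \<open>R\<close> are analysed;
iterating it replaces the normal form \<open>\<Sum> c\<^sub>n x\<^sup>n\<close>.\<close>

lemma R_decompose:
  assumes "r \<in> R"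
  shows "\<exists>c. \<exists>r'\<in>R. r = scal c \<oplus> r' \<otimes> x"
  using assms[unfolded R_def]
proof (induction rule: generate_ring.induct)
  case one
  show ?case
    by (rule exI[of _ 1], rule bexI[of _ \<zero>]) (auto simp: scal_one)
next
  case (incl h)
  then consider c where "h = scal c" | "h = x" by auto
  then show ?case
  proof cases
    case 1
    then show ?thesis by (intro exI[of _ c] bexI[of _ \<zero>]) auto
  next
    case 2
    then show ?thesis by (intro exI[of _ 0] bexI[of _ \<one>]) (auto simp: scal_zero)
  qed
next
  case (a_inv h)
  then obtain c r' where "r' \<in> R" "h = scal c \<oplus> r' \<otimes> x" by auto
  then show ?case
    by (intro exI[of _ "- c"] bexI[of _ "\<ominus> r'"]) (auto simp: scal_minus minus_add l_minus)
next
  case (eng_add h1 h2)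
  then obtain c r c' r' where "r \<in> R" "h1 = scal c \<oplus> r \<otimes> x" "r' \<in> R" "h2 = scal c' \<oplus> r' \<otimes> x"
    by auto
  then show ?case
    by (intro exI[of _ "c + c'"] bexI[of _ "r \<oplus> r'"]) (auto simp: scal_add l_distr a_ac)
next
  case (eng_mult h1 h2)
  then obtain c r c' r' where *: "r \<in> R" "h1 = scal c \<oplus> r \<otimes> x" "r' \<in> R" "h2 = scal c' \<oplus> r' \<otimes> x"
    by auto
  then have "h1 \<otimes> h2 = h1 \<otimes> scal c' \<oplus> h1 \<otimes> r' \<otimes> x"
    by (simp add: r_distr m_assoc)
  also have "h1 \<otimes> scal c' = scal (c * c') \<oplus> r \<otimes> scal c' \<otimes> x"
    using * scal_central[of x c'] by (simp add: scal_mult l_distr m_assoc)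
  finally have "h1 \<otimes> h2 = scal (c * c') \<oplus> (r \<otimes> scal c' \<oplus> h1 \<otimes> r') \<otimes> x"
    using * by (simp add: l_distr a_assoc)
  then show ?case
    using * by (intro exI[of _ "c * c'"] bexI[of _ "r \<otimes> scal c' \<oplus> h1 \<otimes> r'"]) auto
qed

text \<open>Constant terms are split off until the first nonzero one appears; by nilpotency of \<open>x\<close>
that happens in fewer than \<open>N\<close> steps unless \<open>r = 0\<close>.\<close>

lemma R_factor:
  assumes "r \<in> R" "r \<noteq> \<zero>"
  obtains m c r' where "m < N" "c \<noteq> 0" "r' \<in> R" "r = scal c \<otimes> (\<one> \<oplus> r' \<otimes> x) \<otimes> x [^] m"
proof -
  have "(\<exists>m<n. \<exists>c. c \<noteq> 0 \<and> (\<exists>r'\<in>R. r = scal c \<otimes> (\<one> \<oplus> r' \<otimes> x) \<otimes> x [^] m)) \<or>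
        (\<exists>r'\<in>R. r = r' \<otimes> x [^] n)" for n :: nat
  proof (induction n)
    case 0
    then show ?case using assms by (auto intro: bexI[of _ r])
  next
    case (Suc n)
    then consider m c r' where "m < n" "c \<noteq> 0" "r' \<in> R"
        "r = scal c \<otimes> (\<one> \<oplus> r' \<otimes> x) \<otimes> x [^] m"
      | r' where "r' \<in> R" "r = r' \<otimes> x [^] n" by auto
    then show ?case
    proof cases
      case 1
      then show ?thesis using less_SucI by blast
    next
      case 2
      obtain c q where q: "q \<in> R" "r' = scal c \<oplus> q \<otimes> x"
        using R_decompose[OF 2(1)] by auto
      show ?thesis
      proof (cases "c = 0")
        case True
        then have "r = q \<otimes> x [^] Suc n"
          using 2 q by (simp add: scal_zero m_assoc R_commute)
        then show ?thesis using q by blast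
      next
        case False
        then have "scal c \<otimes> scal (1 / c) = \<one>"
          by (simp flip: scal_mult add: scal_one)
        then have "r' = scal c \<otimes> (\<one> \<oplus> (scal (1 / c) \<otimes> q) \<otimes> x)"
          using q by (simp add: r_distr m_assoc flip: m_assoc[of "scal c" "scal (1/c)"])
        then show ?thesis using 2 q False
          by (intro disjI1 exI[of _ n]) (auto intro!: exI[of _ c] bexI[of _ "scal (1 / c) \<otimes> q"])
      qed
    qed
  qed
  from this[of N] show ?thesis
    using that assms by (auto simp: x_nilpotent)
qed

text \<open>If \<open>(1 + r x) g = 1 + h x\<^sup>n\<close>, then replacing \<open>g\<close> by \<open>g - h x\<^sup>n\<close> improves the error
term to \<open>- r h x\<^bsup>n+1\<^esup>\<close>.  After \<open>N\<close> steps the error vanishes.\<close>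

lemma one_plus_inverse:
  assumes "r \<in> R"
  obtains g where "g \<in> R" "(\<one> \<oplus> r \<otimes> x) \<otimes> g = \<one>" "g \<otimes> (\<one> \<oplus> r \<otimes> x) = \<one>"
proof -
  have "\<exists>g\<in>R. \<exists>h\<in>R. (\<one> \<oplus> r \<otimes> x) \<otimes> g = \<one> \<oplus> h \<otimes> x [^] n" for n :: nat
  proof (induction n)
    case 0
    show ?case using assms by (intro bexI[of _ \<one>] bexI[of _ "r \<otimes> x"]) auto
  next
    case (Suc n)
    then obtain g h where gh: "g \<in> R" "h \<in> R" "(\<one> \<oplus> r \<otimes> x) \<otimes> g = \<one> \<oplus> h \<otimes> x [^] n" by auto
    then have "(\<one> \<oplus> r \<otimes> x) \<otimes> (g \<ominus> h \<otimes> x [^] n) =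
        \<one> \<oplus> h \<otimes> x [^] n \<ominus> (\<one> \<oplus> r \<otimes> x) \<otimes> (h \<otimes> x [^] n)"
      using assms by (simp add: minus_eq r_distr r_minus)
    also have "\<dots> = \<one> \<oplus> (\<ominus> (r \<otimes> h)) \<otimes> x [^] Suc n"
    proof -
      have *: "(\<one> \<oplus> r \<otimes> x) \<otimes> (h \<otimes> x [^] n) = h \<otimes> x [^] n \<oplus> r \<otimes> h \<otimes> x [^] Suc n"
        using assms gh R_commute[of x "h \<otimes> x [^] n"] by (simp add: l_distr m_assoc)
      have a: "\<one> \<oplus> p \<ominus> (p \<oplus> q) = \<one> \<oplus> \<ominus> q" if "p \<in> carrier A" "q \<in> carrier A" for p q
        using that by (simp add: minus_eq minus_add a_assoc r_neg2)
      show ?thesis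
        unfolding * using assms gh by (subst a) (simp_all add: l_minus)
    qed
    finally show ?case
      using assms gh unfolding minus_eq
      by (intro bexI[of _ "g \<oplus> \<ominus> (h \<otimes> x [^] n)"] bexI[of _ "\<ominus> (r \<otimes> h)"]) auto
  qed
  from this[of N] obtain g h where "g \<in> R" "h \<in> R" "(\<one> \<oplus> r \<otimes> x) \<otimes> g = \<one>"
    by (auto simp: x_nilpotent)
  then show ?thesis using that assms R_commute[of "\<one> \<oplus> r \<otimes> x" g] by auto
qed

section \<open>Multiplication by the idempotents\<close>

lemma funpow_in_S [simp]: "s \<in> S \<Longrightarrow> (\<omega> ^^ n) s \<in> S"
  using permutes_in_image[OF permutes_funpow[OF perm]] by simp

lemma e_x_pow: "s \<in> S \<Longrightarrow> e s \<otimes> x [^] n = x [^] n \<otimes> e ((\<omega> ^^ n) s)"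
proof (induction n)
  case (Suc n)
  have [simp]: "\<omega> ((\<omega> ^^ n) s) \<in> S"
    using funpow_in_S[of s "Suc n"] Suc.prems by simp
  have "e s \<otimes> x [^] Suc n = x [^] n \<otimes> (e ((\<omega> ^^ n) s) \<otimes> x)"
    using Suc by (simp add: m_assoc[symmetric])
  also have "\<dots> = x [^] Suc n \<otimes> e ((\<omega> ^^ Suc n) s)"
    using Suc.prems by (simp add: e_x m_assoc)
  finally show ?case .
qed simp

lemma e_x_pow_e:
  assumes "u \<in> S" "v \<in> S"
  shows "e u \<otimes> x [^] n \<otimes> e v = (if (\<omega> ^^ n) u = v then e u \<otimes> x [^] n else \<zero>)"
  using assms by (auto simp: e_x_pow m_assoc e_e)

text \<open>On a single power, \<open>e\<^sub>u x\<^sup>n e\<^sub>v\<close> is \<open>e\<^sub>u x\<^sup>n = x\<^sup>n e\<^sub>v\<close> or zero, so deleting from \<open>r\<close> the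
terms with \<open>\<omega>\<^sup>n u \<noteq> v\<close> gives one \<open>r'\<close> that serves on both sides.  The deletion is done term
by term, from the top power downwards.\<close>

lemma R_corner:
  assumes "u \<in> S" "v \<in> S" "r \<in> R"
  shows "\<exists>r'\<in>R. e u \<otimes> r \<otimes> e v = r' \<otimes> e v \<and> e u \<otimes> r \<otimes> e v = e u \<otimes> r'"
proof -
  have "\<exists>r'\<in>R. e u \<otimes> (r \<otimes> x [^] (N - k)) \<otimes> e v = r' \<otimes> e v \<and>
      e u \<otimes> (r \<otimes> x [^] (N - k)) \<otimes> e v = e u \<otimes> r'" if "k \<le> N" "r \<in> R" for k r
    using that
  proof (induction k arbitrary: r)
    case 0
    then show ?case using assms by (intro bexI[of _ \<zero>]) (auto simp: x_nilpotent)
  next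
    case (Suc k)
    define n where "n = N - Suc k"
    have n: "N - k = Suc n" using Suc.prems by (simp add: n_def)
    obtain c q where q: "q \<in> R" "r = scal c \<oplus> q \<otimes> x"
      using R_decompose Suc.prems by blast
    obtain p where p: "p \<in> R" "e u \<otimes> (q \<otimes> x [^] Suc n) \<otimes> e v = p \<otimes> e v"
        "e u \<otimes> (q \<otimes> x [^] Suc n) \<otimes> e v = e u \<otimes> p"
      using Suc.IH[of q] Suc.prems q unfolding n by auto
    \<comment> \<open>the coefficient of \<open>x\<^sup>n\<close> survives exactly when the path of length \<open>n\<close> from \<open>u\<close> ends in \<open>v\<close>\<close>
    define d where "d = (if (\<omega> ^^ n) u = v then c else 0)"
    have "e u \<otimes> (scal c \<otimes> x [^] n) \<otimes> e v = scal c \<otimes> (e u \<otimes> x [^] n \<otimes> e v)"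
      using assms by (simp add: m_assoc[symmetric] scal_central[of "e u"])
    also have "\<dots> = scal d \<otimes> (e u \<otimes> x [^] n)"
      using assms by (auto simp: d_def e_x_pow_e scal_zero)
    finally have d: "e u \<otimes> (scal c \<otimes> x [^] n) \<otimes> e v = scal d \<otimes> (e u \<otimes> x [^] n)" .
    then have d1: "e u \<otimes> (scal c \<otimes> x [^] n) \<otimes> e v = e u \<otimes> (scal d \<otimes> x [^] n)"
      using assms by (simp add: m_assoc[symmetric] scal_central[of "e u"])
    have d2: "e u \<otimes> (scal c \<otimes> x [^] n) \<otimes> e v = (scal d \<otimes> x [^] n) \<otimes> e v"
      unfolding d using assms by (auto simp: d_def e_x_pow m_assoc scal_zero)
    have "r \<otimes> x [^] n = scal c \<otimes> x [^] n \<oplus> q \<otimes> x [^] Suc n"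
      using q by (simp add: l_distr m_assoc R_commute[of x])
    then have split: "e u \<otimes> (r \<otimes> x [^] n) \<otimes> e v =
        e u \<otimes> (scal c \<otimes> x [^] n) \<otimes> e v \<oplus> e u \<otimes> (q \<otimes> x [^] Suc n) \<otimes> e v"
      using q assms by (simp add: l_distr r_distr)
    show ?case
      unfolding n_def[symmetric]
    proof (intro bexI[of _ "scal d \<otimes> x [^] n \<oplus> p"] conjI)
      show "e u \<otimes> (r \<otimes> x [^] n) \<otimes> e v = (scal d \<otimes> x [^] n \<oplus> p) \<otimes> e v"
        using split d2 p assms by (simp add: l_distr)
      show "e u \<otimes> (r \<otimes> x [^] n) \<otimes> e v = e u \<otimes> (scal d \<otimes> x [^] n \<oplus> p)"
        using split d1 p assms by (simp add: r_distr)
    qed (use p in auto)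
  qed
  from this[of N r] show ?thesis using assms by auto
qed

lemma generated_induct [consumes 1, case_names one scal x e minus add mult]:
  assumes "a \<in> carrier A" and "P \<one>" "\<And>c. P (scal c)" "P x" "\<And>s. s \<in> S \<Longrightarrow> P (e s)"
    and "\<And>a. a \<in> carrier A \<Longrightarrow> P a \<Longrightarrow> P (\<ominus> a)"
    and "\<And>a b. a \<in> carrier A \<Longrightarrow> b \<in> carrier A \<Longrightarrow> P a \<Longrightarrow> P b \<Longrightarrow> P (a \<oplus> b)"
    and "\<And>a b. a \<in> carrier A \<Longrightarrow> b \<in> carrier A \<Longrightarrow> P a \<Longrightarrow> P b \<Longrightarrow> P (a \<otimes> b)"
  shows "P a"
proof -
  have "a \<in> generate_ring A (range scal \<union> {x} \<union> e ` S)" using assms generated by simp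
  then have "a \<in> carrier A \<and> P a"
  proof (induction rule: generate_ring.induct)
    case (incl h)
    then show ?case using assms(3-5) by auto
  qed (use assms(2,6-8) in auto)
  then show ?thesis ..
qed

text \<open>The elements \<open>a\<close> with \<open>e\<^sub>u R a \<subseteq> e\<^sub>u R\<close> form a subring.  It contains the generators, the
idempotents by the corner lemma.\<close>

lemma e_mult_carrier:
  assumes "a \<in> carrier A" "u \<in> S"
  obtains r where "r \<in> R" "e u \<otimes> a = e u \<otimes> r"
proof -
  have "\<forall>r\<in>R. \<exists>r'\<in>R. e u \<otimes> r \<otimes> a = e u \<otimes> r'"
    using assms(1)
  proof (induction rule: generated_induct)
    case (e s)
    then show ?case using R_corner[OF assms(2) e] by blast
  next
    case (minus a)
    show ?case
    proof
      fix r assume r: "r \<in> R"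
      with minus obtain r' where "r' \<in> R" "e u \<otimes> r \<otimes> a = e u \<otimes> r'" by blast
      then show "\<exists>r'\<in>R. e u \<otimes> r \<otimes> \<ominus> a = e u \<otimes> r'"
        using r minus assms by (intro bexI[of _ "\<ominus> r'"]) (auto simp: r_minus)
    qed
  next
    case (add a b)
    show ?case
    proof
      fix r assume r: "r \<in> R"
      with add obtain r1 r2 where "r1 \<in> R" "e u \<otimes> r \<otimes> a = e u \<otimes> r1"
        "r2 \<in> R" "e u \<otimes> r \<otimes> b = e u \<otimes> r2" by blast
      then show "\<exists>r'\<in>R. e u \<otimes> r \<otimes> (a \<oplus> b) = e u \<otimes> r'"
        using r add assms by (intro bexI[of _ "r1 \<oplus> r2"]) (auto simp: r_distr)
    qed
  next
    case (mult a b)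
    show ?case
    proof
      fix r assume r: "r \<in> R"
      with mult obtain r1 where r1: "r1 \<in> R" "e u \<otimes> r \<otimes> a = e u \<otimes> r1" by blast
      with mult obtain r2 where r2: "r2 \<in> R" "e u \<otimes> r1 \<otimes> b = e u \<otimes> r2" by blast
      have "e u \<otimes> r \<otimes> (a \<otimes> b) = (e u \<otimes> r \<otimes> a) \<otimes> b"
        using r mult assms by (simp add: m_assoc)
      then show "\<exists>r'\<in>R. e u \<otimes> r \<otimes> (a \<otimes> b) = e u \<otimes> r'"
        using r1 r2 by auto
    qed
  next
    case (scal c)
    show ?case using assms(2) by (auto simp: m_assoc)
  next
    case x
    show ?case using assms(2) by (auto simp: m_assoc)
  next
    case one
    show ?case using assms(2) by auto
  qed
  from bspec[OF this R_one] show ?thesis using that assms by auto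
qed

text \<open>The mirror image of the previous argument, for the subring of those \<open>a\<close> with
\<open>a R e\<^sub>v \<subseteq> R e\<^sub>v\<close>.\<close>

lemma carrier_mult_e:
  assumes "a \<in> carrier A" "v \<in> S"
  obtains r where "r \<in> R" "a \<otimes> e v = r \<otimes> e v"
proof -
  have "\<forall>r\<in>R. \<exists>r'\<in>R. a \<otimes> (r \<otimes> e v) = r' \<otimes> e v"
    using assms(1)
  proof (induction rule: generated_induct)
    case (e s)
    then show ?case using R_corner[OF e assms(2)] assms(2) by (simp add: m_assoc) blast
  next
    case (minus a)
    show ?case
    proof
      fix r assume r: "r \<in> R"
      with minus obtain r' where "r' \<in> R" "a \<otimes> (r \<otimes> e v) = r' \<otimes> e v" by blast
      then show "\<exists>r'\<in>R. \<ominus> a \<otimes> (r \<otimes> e v) = r' \<otimes> e v"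
        using r minus assms by (intro bexI[of _ "\<ominus> r'"]) (auto simp: l_minus)
    qed
  next
    case (add a b)
    show ?case
    proof
      fix r assume r: "r \<in> R"
      with add obtain r1 r2 where "r1 \<in> R" "a \<otimes> (r \<otimes> e v) = r1 \<otimes> e v"
        "r2 \<in> R" "b \<otimes> (r \<otimes> e v) = r2 \<otimes> e v" by blast
      then show "\<exists>r'\<in>R. (a \<oplus> b) \<otimes> (r \<otimes> e v) = r' \<otimes> e v"
        using r add assms by (intro bexI[of _ "r1 \<oplus> r2"]) (auto simp: l_distr)
    qed
  next
    case (mult a b)
    show ?case
    proof
      fix r assume r: "r \<in> R"
      with mult obtain r1 where r1: "r1 \<in> R" "b \<otimes> (r \<otimes> e v) = r1 \<otimes> e v" by blast
      with mult obtain r2 where r2: "r2 \<in> R" "a \<otimes> (r1 \<otimes> e v) = r2 \<otimes> e v" by blast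
      have "a \<otimes> b \<otimes> (r \<otimes> e v) = a \<otimes> (b \<otimes> (r \<otimes> e v))"
        using r mult assms by (simp add: m_assoc)
      then show "\<exists>r'\<in>R. a \<otimes> b \<otimes> (r \<otimes> e v) = r' \<otimes> e v"
        using r1 r2 by auto
    qed
  next
    case (scal c)
    show ?case using assms(2) by (auto simp flip: m_assoc)
  next
    case x
    show ?case using assms(2) by (auto simp flip: m_assoc)
  next
    case one
    show ?case using assms(2) by auto
  qed
  from bspec[OF this R_one] show ?thesis using that assms by auto
qed

text \<open>This is how \<open>1 = \<Sum> e\<^sub>v\<close> is used: \<open>y\<close> is the sum of its components \<open>y e\<^sub>v\<close>.\<close>

lemma mem_if_mult_e_mem:
  assumes y: "y \<in> carrier A" and "\<And>v. v \<in> S \<Longrightarrow> y \<otimes> e v \<in> M"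
    and M: "M \<subseteq> carrier A" "\<zero> \<in> M" "\<And>a b. a \<in> M \<Longrightarrow> b \<in> M \<Longrightarrow> a \<oplus> b \<in> M"
  shows "y \<in> M"
proof -
  have "finsum A (\<lambda>v. y \<otimes> e v) T \<in> M" if "T \<subseteq> S" for T
    using finite_subset[OF that finite_S] that
  proof (induction T rule: finite_induct)
    case (insert v T)
    have "finsum A (\<lambda>v. y \<otimes> e v) (insert v T) = y \<otimes> e v \<oplus> finsum A (\<lambda>v. y \<otimes> e v) T"
      using insert y by (intro finsum_insert) auto
    then show ?case using insert assms by auto
  qed (use M in simp)
  from this[of S] have "finsum A (\<lambda>v. y \<otimes> e v) S \<in> M" by simp
  also have "finsum A (\<lambda>v. y \<otimes> e v) S = y \<otimes> finsum A e S"
    using y finite_S by (subst finsum_rdistr) auto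
  finally show ?thesis using y by (simp add: sum_e)
qed

section \<open>The right ideals generated by paths and their translates\<close>

lemma e_x_pow_eq_zero_iff:
  assumes "s \<in> S"
  shows "e s \<otimes> x [^] n = \<zero> \<longleftrightarrow> N \<le> n"
proof
  assume *: "e s \<otimes> x [^] n = \<zero>"
  show "N \<le> n"
  proof (rule ccontr)
    assume "\<not> N \<le> n"
    then have "x [^] (N - 1) = x [^] n \<otimes> x [^] (N - 1 - n)"
      by (simp add: nat_pow_mult)
    then have "e s \<otimes> x [^] (N - 1) = \<zero>"
      using * assms by (simp add: m_assoc[symmetric])
    then show False using socle_nonzero assms by simp
  qed
qed (use assms in \<open>simp add: x_pow_zero\<close>)

lemma e_x_pow_carrier:
  assumes "s \<in> S" "a \<in> carrier A"
  shows "e s \<otimes> x [^] t \<otimes> a \<in> path_module s t"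
proof -
  obtain r where "r \<in> R" "e ((\<omega> ^^ t) s) \<otimes> a = e ((\<omega> ^^ t) s) \<otimes> r"
    using e_mult_carrier[of a "(\<omega> ^^ t) s"] assms by auto
  then have "e s \<otimes> x [^] t \<otimes> a = e s \<otimes> x [^] t \<otimes> r"
    using assms by (simp add: e_x_pow m_assoc)
  then show ?thesis using \<open>r \<in> R\<close> unfolding path_module_def by blast
qed

text \<open>Hence \<open>N\<^sub>s\<^sub>,\<^sub>t\<close> is the principal right ideal generated by \<open>e\<^sub>s x\<^sup>t\<close>.\<close>

lemma path_module_eq:
  "s \<in> S \<Longrightarrow> path_module s t = {e s \<otimes> x [^] t \<otimes> a | a. a \<in> carrier A}"
  using e_x_pow_carrier[of s _ t] unfolding path_module_def by auto

lemma translate_path_module_right_ideal: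
  assumes "h \<in> carrier A" "s \<in> S"
  shows "right_ideal ((\<lambda>n. h \<otimes> n) ` path_module s t) A"
proof (rule right_idealI)
  show "(\<lambda>n. h \<otimes> n) ` path_module s t \<subseteq> carrier A"
    using assms by (auto simp: path_module_def)
  show "\<zero> \<in> (\<lambda>n. h \<otimes> n) ` path_module s t"
    using assms by (auto simp: path_module_eq image_iff intro!: exI[of _ \<zero>])
next
  fix a b
  assume "a \<in> (\<lambda>n. h \<otimes> n) ` path_module s t" "b \<in> (\<lambda>n. h \<otimes> n) ` path_module s t"
  then obtain a' b' where *: "a' \<in> carrier A" "b' \<in> carrier A"
    "a = h \<otimes> (e s \<otimes> x [^] t \<otimes> a')" "b = h \<otimes> (e s \<otimes> x [^] t \<otimes> b')"
    using assms by (auto simp: path_module_eq)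
  then have "a \<oplus> b = h \<otimes> (e s \<otimes> x [^] t \<otimes> (a' \<oplus> b'))"
    using assms by (simp add: r_distr)
  then show "a \<oplus> b \<in> (\<lambda>n. h \<otimes> n) ` path_module s t"
    using e_x_pow_carrier[of s "a' \<oplus> b'"] assms * by auto
next
  fix a b
  assume "a \<in> (\<lambda>n. h \<otimes> n) ` path_module s t" "b \<in> carrier A"
  then obtain a' where *: "a' \<in> carrier A" "a = h \<otimes> (e s \<otimes> x [^] t \<otimes> a')" "b \<in> carrier A"
    using assms by (auto simp: path_module_eq)
  then have "a \<otimes> b = h \<otimes> (e s \<otimes> x [^] t \<otimes> (a' \<otimes> b))"
    using assms by (simp add: m_assoc)
  then show "a \<otimes> b \<in> (\<lambda>n. h \<otimes> n) ` path_module s t"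
    using e_x_pow_carrier[of s "a' \<otimes> b"] assms * by auto
qed

text \<open>Writing \<open>n = e\<^sub>s x\<^sup>t c (1 + r' x) x\<^sup>m\<close>, the unit \<open>c (1 + r' x)\<close> can be cancelled by
commutativity of \<open>R\<close>, which leaves \<open>e\<^sub>s x\<^bsup>t+m\<^esup>\<close>, and the exponent can be raised to \<open>N - 1\<close>.\<close>

lemma path_module_socle:
  assumes "s \<in> S" "n \<in> path_module s t" "n \<noteq> \<zero>"
  obtains q where "q \<in> R" "n \<otimes> q = e s \<otimes> x [^] (N - 1)"
proof -
  obtain r where r: "r \<in> R" "n = e s \<otimes> x [^] t \<otimes> r"
    using assms by (auto simp: path_module_def)
  then have "r \<noteq> \<zero>" using assms by auto
  then obtain m c r' where f: "m < N" "c \<noteq> 0" "r' \<in> R" "r = scal c \<otimes> (\<one> \<oplus> r' \<otimes> x) \<otimes> x [^] m"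
    using R_factor r by metis
  obtain g where g: "g \<in> R" "(\<one> \<oplus> r' \<otimes> x) \<otimes> g = \<one>"
    using one_plus_inverse f by metis
  define w where "w = scal (1 / c) \<otimes> g"
  have w: "w \<in> R" "scal c \<otimes> (\<one> \<oplus> r' \<otimes> x) \<otimes> w = \<one>"
  proof -
    have "scal c \<otimes> (\<one> \<oplus> r' \<otimes> x) \<otimes> w = (scal c \<otimes> scal (1 / c)) \<otimes> ((\<one> \<oplus> r' \<otimes> x) \<otimes> g)"
      using f(3) g(1) scal_central[of "\<one> \<oplus> r' \<otimes> x" "1 / c"] unfolding w_def
      by (simp add: m_assoc) (simp add: m_assoc[symmetric])
    then show "scal c \<otimes> (\<one> \<oplus> r' \<otimes> x) \<otimes> w = \<one>"
      using g f by (simp flip: scal_mult add: scal_one)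
  qed (use g in \<open>simp add: w_def\<close>)
  have n: "n \<otimes> w = e s \<otimes> x [^] (t + m)"
  proof -
    have "r \<otimes> w = scal c \<otimes> (\<one> \<oplus> r' \<otimes> x) \<otimes> w \<otimes> x [^] m"
      using f w(1) R_commute[of "x [^] m" w] by (simp add: m_assoc)
    then have "r \<otimes> w = x [^] m" using w by simp
    then show ?thesis
      using r w assms by (simp add: m_assoc nat_pow_mult)
  qed
  have "t + m < N"
  proof (rule ccontr)
    assume "\<not> t + m < N"
    moreover have "n = e s \<otimes> (x [^] t \<otimes> x [^] m) \<otimes> (scal c \<otimes> (\<one> \<oplus> r' \<otimes> x))"
      using r f assms R_commute[of "scal c \<otimes> (\<one> \<oplus> r' \<otimes> x)" "x [^] m"] by (simp add: m_assoc)
    ultimately show False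
      using assms f by (simp add: nat_pow_mult x_pow_zero)
  qed
  then have "n \<otimes> (w \<otimes> x [^] (N - 1 - (t + m))) = e s \<otimes> x [^] (N - 1)"
    using n w assms r by (simp add: m_assoc[symmetric]) (simp add: m_assoc nat_pow_mult)
  then show ?thesis
    using w by (intro that[of "w \<otimes> x [^] (N - 1 - (t + m))"]) auto
qed

lemma translate_path_module_indecomposable:
  assumes h: "h \<in> R" "g \<in> R" "g \<otimes> h = \<one>" and s: "s \<in> S" "t \<le> N - 1"
  shows "indecomposable_right_ideal A ((\<lambda>n. h \<otimes> n) ` path_module s t)"
proof (rule indecomposable_uniform)
  let ?z = "h \<otimes> (e s \<otimes> x [^] (N - 1))"
  show "right_ideal ((\<lambda>n. h \<otimes> n) ` path_module s t) A"
    using h s by (simp add: translate_path_module_right_ideal)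
  have g: "g \<otimes> (h \<otimes> a) = a" if "a \<in> carrier A" for a
    using that h by (simp add: m_assoc[symmetric])
  show "?z \<noteq> \<zero>"
    using g[of "e s \<otimes> x [^] (N - 1)"] socle_nonzero[OF s(1)] s h by auto
  have "e s \<otimes> x [^] (N - 1) = e s \<otimes> x [^] t \<otimes> x [^] (N - 1 - t)"
  proof -
    have "t + (N - 1 - t) = N - 1" using s by simp
    then have "x [^] (N - 1) = x [^] t \<otimes> x [^] (N - 1 - t)"
      using nat_pow_mult[OF x_closed, of t "N - 1 - t"] by (simp only:)
    then show ?thesis using s by (simp add: m_assoc)
  qed
  then show "?z \<in> (\<lambda>n. h \<otimes> n) ` path_module s t"
    using e_x_pow_carrier[of s "x [^] (N - 1 - t)" t] s by simp
next
  let ?z = "h \<otimes> (e s \<otimes> x [^] (N - 1))"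
  fix J assume J: "right_ideal J A" "J \<subseteq> (\<lambda>n. h \<otimes> n) ` path_module s t" "J \<noteq> {\<zero>}"
  interpret J: right_ideal J A by fact
  obtain j where j: "j \<in> J" "j \<noteq> \<zero>" using J(3) J.zero_closed by blast
  then obtain n where n: "n \<in> path_module s t" "j = h \<otimes> n" using J by auto
  then have "n \<in> carrier A" "n \<noteq> \<zero>" using h s j by (auto simp: path_module_def)
  then obtain q where "q \<in> R" "n \<otimes> q = e s \<otimes> x [^] (N - 1)"
    using path_module_socle n s by metis
  then have "?z = j \<otimes> q" using n h \<open>n \<in> carrier A\<close> by (simp add: m_assoc)
  then show "?z \<in> J" using j \<open>q \<in> R\<close> by (simp add: J.I_r_closed)
qed

section \<open>Classification of the indecomposable right ideals\<close>

lemma funpow_S_surj: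
  assumes "v \<in> S"
  obtains s where "s \<in> S" "(\<omega> ^^ n) s = v"
  using permutes_image[OF permutes_funpow[OF perm], of n] assms that by (metis imageE)

lemma funpow_inj: "(\<omega> ^^ n) s = (\<omega> ^^ n) s' \<Longrightarrow> s = s'"
  using permutes_inj[OF permutes_funpow[OF perm], of n] by (auto dest: injD)

text \<open>The summand is found from an element of \<open>I\<close> of least order; see the introduction.  Conjugating
\<open>e\<^sub>s\<close> by the unit \<open>h\<close> produces the splitting idempotent inside \<open>A\<close> itself, so that \<open>I\<close> need
not be moved by \<open>h\<^sup>-\<^sup>1\<close> first.\<close>

lemma indecomposable_is_translate:
  assumes I: "indecomposable_right_ideal A I"
  shows "\<exists>r\<in>R. \<exists>s\<in>S. \<exists>t\<le>N - 1. I = (\<lambda>n. (\<one> \<oplus> r \<otimes> x) \<otimes> n) ` path_module s t"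
proof -
  interpret I: right_ideal I A
    using I by (simp add: indecomposable_right_ideal_def)
  define P where "P t \<longleftrightarrow> t < N \<and> (\<exists>v\<in>S. \<exists>r\<in>R. (\<one> \<oplus> r \<otimes> x) \<otimes> x [^] t \<otimes> e v \<in> I)" for t
  \<comment> \<open>a nonzero component \<open>y e\<^sub>v\<close> of order \<open>m\<close> shows \<open>P m\<close>, after removal of the leading coefficient\<close>
  have order: "y \<otimes> e v = \<zero> \<or> (\<exists>m. P m \<and> (\<exists>a\<in>carrier A. y \<otimes> e v = x [^] m \<otimes> a))"
    if y: "y \<in> I" and v: "v \<in> S" for y v
  proof (cases "y \<otimes> e v = \<zero>")
    case False
    obtain r where r: "r \<in> R" "y \<otimes> e v = r \<otimes> e v"
      using carrier_mult_e[of y v] y v by auto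
    with False v have "r \<noteq> \<zero>" by auto
    then obtain m c q where m: "m < N" "c \<noteq> 0" "q \<in> R" "r = scal c \<otimes> (\<one> \<oplus> q \<otimes> x) \<otimes> x [^] m"
      using R_factor r by metis
    let ?w = "(\<one> \<oplus> q \<otimes> x) \<otimes> x [^] m \<otimes> e v"
    have "y \<otimes> e v = scal c \<otimes> ?w" using r m v by (simp add: m_assoc)
    then have "y \<otimes> e v \<otimes> scal (1 / c) = scal (1 / c) \<otimes> scal c \<otimes> ?w"
      using m v scal_central[of "scal c \<otimes> ?w" "1 / c"] by (simp add: m_assoc)
    also have "scal (1 / c) \<otimes> scal c = \<one>"
      using m by (simp flip: scal_mult add: scal_one)
    finally have "?w = y \<otimes> e v \<otimes> scal (1 / c)" using m v by simp
    then have "?w \<in> I" using y v by (simp add: I.I_r_closed)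
    then have "P m" using m v unfolding P_def by blast
    moreover have "y \<otimes> e v = x [^] m \<otimes> (scal c \<otimes> (\<one> \<oplus> q \<otimes> x) \<otimes> e v)"
      using r m v R_commute[of "x [^] m" "scal c \<otimes> (\<one> \<oplus> q \<otimes> x)"]
      by (simp add: m_assoc[symmetric])
    ultimately show ?thesis
      using m v by (intro disjI2 exI[of _ m]) auto
  qed simp
  have "\<exists>t. P t"
  proof (rule ccontr)
    assume "\<not> (\<exists>t. P t)"
    then have "y \<otimes> e v = \<zero>" if "y \<in> I" "v \<in> S" for y v
      using order that by blast
    then have "y = \<zero>" if "y \<in> I" for y
      using mem_if_mult_e_mem[of y "{\<zero>}"] that by auto
    then have "I = {\<zero>}" by auto
    then show False using I by (simp add: indecomposable_right_ideal_def)
  qed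
  define t where "t = (LEAST t. P t)"
  have "P t" and least: "\<And>m. P m \<Longrightarrow> t \<le> m"
    using \<open>\<exists>t. P t\<close> unfolding t_def by (auto intro: LeastI_ex Least_le)
  then obtain v r where t: "t < N" and v: "v \<in> S" and r: "r \<in> R"
    and vI: "(\<one> \<oplus> r \<otimes> x) \<otimes> x [^] t \<otimes> e v \<in> I"
    unfolding P_def by auto
  \<comment> \<open>least order \<open>t\<close> means \<open>I \<subseteq> x\<^sup>t A\<close>\<close>
  have I_sub: "\<exists>a\<in>carrier A. y = x [^] t \<otimes> a" if y: "y \<in> I" for y
  proof -
    have "y \<in> {x [^] t \<otimes> a | a. a \<in> carrier A}"
    proof (rule mem_if_mult_e_mem)
      fix v assume v: "v \<in> S"
      consider "y \<otimes> e v = \<zero>" | m a where "P m" "a \<in> carrier A" "y \<otimes> e v = x [^] m \<otimes> a"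
        using order[OF y v] by auto
      then show "y \<otimes> e v \<in> {x [^] t \<otimes> a | a. a \<in> carrier A}"
      proof cases
        case 1
        then show ?thesis by (auto intro!: exI[of _ \<zero>])
      next
        case 2
        have "x [^] m = x [^] t \<otimes> x [^] (m - t)"
          using least[OF 2(1)] by (simp add: nat_pow_mult)
        then have "y \<otimes> e v = x [^] t \<otimes> (x [^] (m - t) \<otimes> a)"
          using 2(2,3) by (simp add: m_assoc)
        then show ?thesis using 2(2) by (intro CollectI exI[of _ "x [^] (m - t) \<otimes> a"]) auto
      qed
    next
      show "\<zero> \<in> {x [^] t \<otimes> a | a. a \<in> carrier A}"
        by (auto intro!: exI[of _ \<zero>])
    next
      fix a b
      assume "a \<in> {x [^] t \<otimes> a | a. a \<in> carrier A}" "b \<in> {x [^] t \<otimes> a | a. a \<in> carrier A}"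
      then obtain a' b' where *: "a' \<in> carrier A" "b' \<in> carrier A"
        "a = x [^] t \<otimes> a'" "b = x [^] t \<otimes> b'" by auto
      then have "a \<oplus> b = x [^] t \<otimes> (a' \<oplus> b')" by (simp add: r_distr)
      then show "a \<oplus> b \<in> {x [^] t \<otimes> a | a. a \<in> carrier A}" using * by blast
    qed (use y in auto)
    then show ?thesis by auto
  qed
  obtain s where s: "s \<in> S" "(\<omega> ^^ t) s = v"
    using funpow_S_surj[OF v] by metis
  define h where "h = \<one> \<oplus> r \<otimes> x"
  have h: "h \<in> R" using r by (simp add: h_def)
  obtain g where g: "g \<in> R" "h \<otimes> g = \<one>" "g \<otimes> h = \<one>"
    using one_plus_inverse[OF r] unfolding h_def by metis
  have gh: "g \<otimes> (h \<otimes> a) = a" and hg: "h \<otimes> (g \<otimes> a) = a" if "a \<in> carrier A" for a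
    using that h g by (simp_all add: m_assoc[symmetric])
  define u where "u = h \<otimes> (e s \<otimes> x [^] t)"
  have uI: "u \<in> I"
    using vI r v s by (simp add: u_def h_def m_assoc e_x_pow)
  have sub: "(\<lambda>n. h \<otimes> n) ` path_module s t \<subseteq> I"
  proof
    fix y assume "y \<in> (\<lambda>n. h \<otimes> n) ` path_module s t"
    then obtain a where a: "a \<in> R" "y = h \<otimes> (e s \<otimes> x [^] t \<otimes> a)"
      by (auto simp: path_module_def)
    then have "y = u \<otimes> a" using h s by (simp add: u_def m_assoc)
    then show "y \<in> I" using uI a by (simp add: I.I_r_closed)
  qed
  define f where "f = h \<otimes> e s \<otimes> g"
  have f: "f \<in> carrier A" using h g s by (simp add: f_def)
  have ff: "f \<otimes> f = f"
    using h g s gh by (simp add: f_def m_assoc) (simp add: m_assoc[symmetric] e_e)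
  \<comment> \<open>\<open>g\<close> commutes with \<open>x\<^sup>t\<close>, hence \<open>f x\<^sup>t A = h e\<^sub>s x\<^sup>t g A\<close>\<close>
  have f_translate: "f \<otimes> y \<in> (\<lambda>n. h \<otimes> n) ` path_module s t" if y: "y \<in> I" for y
  proof -
    obtain a where a: "a \<in> carrier A" "y = x [^] t \<otimes> a" using I_sub y by blast
    have "f \<otimes> y = h \<otimes> (e s \<otimes> (g \<otimes> x [^] t) \<otimes> a)"
      using h g s a by (simp add: f_def m_assoc)
    also have "g \<otimes> x [^] t = x [^] t \<otimes> g" using g R_commute by simp
    also have "e s \<otimes> (x [^] t \<otimes> g) \<otimes> a = e s \<otimes> x [^] t \<otimes> (g \<otimes> a)"
      using g s a by (simp add: m_assoc)
    finally show ?thesis using e_x_pow_carrier[of s "g \<otimes> a" t] a g s by auto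
  qed
  have fu: "f \<otimes> u = u"
    using h g s gh by (simp add: f_def u_def m_assoc) (simp add: m_assoc[symmetric] e_e)
  have "u \<noteq> \<zero>"
    using gh[of "e s \<otimes> x [^] t"] s t e_x_pow_eq_zero_iff[of s t] g by (auto simp: u_def)
  then have "f \<otimes> y = y" if "y \<in> I" for y
    using indecomposable_idempotent[OF I f ff _ uI _ that] f_translate sub fu by auto
  then have "I = (\<lambda>n. h \<otimes> n) ` path_module s t"
    using f_translate sub by fastforce
  then show ?thesis using r s t unfolding h_def by (intro bexI exI conjI) auto
qed

text \<open>An injective map reflects annihilation: the power \<open>x\<^bsup>N-t'\<^esup>\<close> kills the target, hence the source, which gives \<open>t' \<le> t\<close>.  The socle generator
\<open>e\<^sub>s x\<^bsup>N-1\<^esup>\<close> is fixed by right multiplication with \<open>e\<^sub>v\<close>, where \<open>v = \<omega>\<^bsup>N-1\<^esup> s\<close>; so is a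
multiple of its image that generates the socle of the target, and \<open>\<omega>\<^bsup>N-1\<^esup>\<close> is injective.\<close>

lemma path_module_embedding:
  assumes s: "s \<in> S" "t \<le> N - 1" and s': "s' \<in> S" "t' \<le> N - 1"
    and f: "f \<in> right_module_hom A (path_module s t) (path_module s' t')"
    and inj: "inj_on f (path_module s t)"
  shows "s = s'" "t' \<le> t"
proof -
  have closed: "e s \<otimes> x [^] t \<otimes> a \<in> path_module s t" if "a \<in> carrier A" for a
    using e_x_pow_carrier s that by simp
  have f_mult: "f (n \<otimes> a) = f n \<otimes> a" if "n \<in> path_module s t" "a \<in> carrier A" for n a
    using f that by (simp add: right_module_hom_def)
  have f_in: "f n \<in> path_module s' t'" if "n \<in> path_module s t" for n
    using f that by (auto simp: right_module_hom_def)
  have carr: "n \<in> carrier A" if "n \<in> path_module s t" for n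
    using that s by (auto simp: path_module_def)
  have carr': "n \<in> carrier A" if "n \<in> path_module s' t'" for n
    using that s' by (auto simp: path_module_def)
  have zero: "\<zero> \<in> path_module s t"
    using closed[of \<zero>] s by simp
  have f_zero: "f \<zero> = \<zero>"
    using f_mult[OF zero, of \<zero>] carr'[OF f_in[OF zero]] by simp
  have f_nonzero: "f n \<noteq> \<zero>" if "n \<in> path_module s t" "n \<noteq> \<zero>" for n
    using inj_onD[OF inj, of n \<zero>] that zero f_zero by auto
  show "t' \<le> t"
  proof (rule ccontr)
    assume "\<not> t' \<le> t"
    define n where "n = e s \<otimes> x [^] t"
    have n: "n \<in> path_module s t" using closed[of \<one>] s by (simp add: n_def)
    obtain r where r: "r \<in> R" "f n = e s' \<otimes> x [^] t' \<otimes> r"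
      using f_in[OF n] by (auto simp: path_module_def)
    have "f (n \<otimes> x [^] (N - t')) = e s' \<otimes> (x [^] t' \<otimes> x [^] (N - t')) \<otimes> r"
      using f_mult[OF n] r s' R_commute[of r "x [^] (N - t')"] by (simp add: m_assoc)
    also have "\<dots> = \<zero>" using r s' N_pos by (simp add: nat_pow_mult x_nilpotent)
    finally have "n \<otimes> x [^] (N - t') = \<zero>"
      using f_nonzero closed[of "x [^] (N - t')"] unfolding n_def by auto
    then have "N \<le> t + (N - t')"
      using e_x_pow_eq_zero_iff[of s "t + (N - t')"] s by (simp add: n_def m_assoc nat_pow_mult)
    then show False using \<open>\<not> t' \<le> t\<close> s' N_pos by simp
  qed
  define z where "z = e s \<otimes> x [^] (N - 1)"
  have "t + (N - 1 - t) = N - 1" using s by simp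
  then have "x [^] (N - 1) = x [^] t \<otimes> x [^] (N - 1 - t)"
    using nat_pow_mult[OF x_closed, of t "N - 1 - t"] by (simp only:)
  then have "z = e s \<otimes> x [^] t \<otimes> x [^] (N - 1 - t)"
    using s by (simp add: z_def m_assoc)
  then have z: "z \<in> path_module s t" using closed by simp
  have "z \<noteq> \<zero>" using socle_nonzero s by (simp add: z_def)
  obtain q where q: "q \<in> R" "f z \<otimes> q = e s' \<otimes> x [^] (N - 1)"
    using path_module_socle[OF s'(1) f_in[OF z]] f_nonzero[OF z \<open>z \<noteq> \<zero>\<close>] by metis
  obtain c p where p: "p \<in> R" "q = scal c \<oplus> p \<otimes> x"
    using R_decompose q by blast
  \<comment> \<open>\<open>z\<close> is killed by \<open>x\<close>, so \<open>q\<close> acts on it through its constant term\<close>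
  have "z \<otimes> (p \<otimes> x) = e s \<otimes> x [^] Suc (N - 1) \<otimes> p"
    using p s R_commute[of p x] by (simp add: z_def m_assoc)
  also have "\<dots> = \<zero>" using N_pos p s by (simp add: x_nilpotent)
  finally have zq: "z \<otimes> q = scal c \<otimes> z"
    using p carr[OF z] by (simp add: r_distr scal_central)
  define v where "v = (\<omega> ^^ (N - 1)) s"
  have v: "v \<in> S" using s by (simp add: v_def)
  have zv: "z \<otimes> e v = z"
    using s v by (simp add: z_def e_x_pow_e v_def)
  have "e s' \<otimes> x [^] (N - 1) \<otimes> e v = f z \<otimes> q \<otimes> e v" using q by simp
  also have "\<dots> = f z \<otimes> (q \<otimes> e v)"
    using q(1) v carr'[OF f_in[OF z]] by (simp add: m_assoc)
  also have "\<dots> = f (z \<otimes> q \<otimes> e v)"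
    using f_mult[OF z, of "q \<otimes> e v"] q(1) v carr[OF z] by (simp add: m_assoc)
  also have "z \<otimes> q \<otimes> e v = z \<otimes> q"
    using zq zv v carr[OF z] by (simp add: m_assoc)
  also have "f (z \<otimes> q) = e s' \<otimes> x [^] (N - 1)"
    using f_mult[OF z, of q] q by simp
  finally have "(\<omega> ^^ (N - 1)) s' = v"
    using e_x_pow_e[OF s'(1) v] socle_nonzero[OF s'(1)] by (metis (full_types))
  then show "s = s'" using funpow_inj unfolding v_def by metis
qed

lemma translate_isomorphic:
  assumes "h \<in> R" "g \<in> R" "g \<otimes> h = \<one>" "s \<in> S"
  shows "right_module_isomorphic A ((\<lambda>n. h \<otimes> n) ` path_module s t) (path_module s t)"
proof -
  have carr: "n \<in> carrier A" if "n \<in> path_module s t" for n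
    using that assms by (auto simp: path_module_def)
  have gh: "g \<otimes> (h \<otimes> a) = a" if "a \<in> carrier A" for a
    using that assms by (simp add: m_assoc[symmetric])
  have "(\<lambda>n. g \<otimes> n) \<in> right_module_hom A ((\<lambda>n. h \<otimes> n) ` path_module s t) (path_module s t)"
    using assms gh carr by (auto simp: right_module_hom_def r_distr m_assoc)
  moreover have "bij_betw (\<lambda>n. g \<otimes> n) ((\<lambda>n. h \<otimes> n) ` path_module s t) (path_module s t)"
    by (rule bij_betwI'[where f = "\<lambda>n. g \<otimes> n"]) (auto simp: gh carr)
  ultimately show ?thesis unfolding right_module_isomorphic_def by blast
qed

theorem indecomposable_right_ideals:
  "(\<forall>s\<in>S. \<forall>t\<le>N - 1. path_module s t \<in> L_in A) \<and>
   (\<forall>I\<in>L_in A. \<exists>!(s, t). s \<in> S \<and> t \<le> N - 1 \<and> right_module_isomorphic A I (path_module s t)) \<and>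
   L_in A = {(\<lambda>n. (\<one> \<oplus> r \<otimes> x) \<otimes> n) ` path_module s t | r s t. r \<in> R \<and> s \<in> S \<and> t \<le> N - 1}"
proof (intro conjI ballI allI impI)
  fix s t assume st: "s \<in> S" "t \<le> N - 1"
  have "(\<lambda>n. \<one> \<otimes> n) ` path_module s t = path_module s t"
    using st by (force simp: path_module_def image_iff)
  then show "path_module s t \<in> L_in A"
    using translate_path_module_indecomposable[of \<one> \<one> s t] st by (simp add: L_in_def)
next
  fix I assume "I \<in> L_in A"
  then have I: "indecomposable_right_ideal A I" "right_ideal I A"
    by (auto simp: L_in_def indecomposable_right_ideal_def)
  obtain r s t where rst: "r \<in> R" "s \<in> S" "t \<le> N - 1" "I = (\<lambda>n. (\<one> \<oplus> r \<otimes> x) \<otimes> n) ` path_module s t"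
    using indecomposable_is_translate[OF I(1)] by blast
  obtain g where "g \<in> R" "g \<otimes> (\<one> \<oplus> r \<otimes> x) = \<one>"
    using one_plus_inverse[OF rst(1)] by metis
  then have iso: "right_module_isomorphic A I (path_module s t)"
    using translate_isomorphic[of "\<one> \<oplus> r \<otimes> x" g s t] rst by simp
  have "s' = s \<and> t' = t"
    if st': "s' \<in> S" "t' \<le> N - 1" "right_module_isomorphic A I (path_module s' t')" for s' t'
  proof -
    obtain f where f: "f \<in> right_module_hom A (path_module s t) (path_module s' t')"
        "inj_on f (path_module s t)"
      using right_module_isomorphic_embedding[OF I(2) iso st'(3)] by blast
    obtain f' where f': "f' \<in> right_module_hom A (path_module s' t') (path_module s t)"
        "inj_on f' (path_module s' t')"
      using right_module_isomorphic_embedding[OF I(2) st'(3) iso] by blast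
    show ?thesis
      using path_module_embedding[OF rst(2,3) st'(1,2) f] path_module_embedding[OF st'(1,2) rst(2,3) f']
      by auto
  qed
  then show "\<exists>!(s, t). s \<in> S \<and> t \<le> N - 1 \<and> right_module_isomorphic A I (path_module s t)"
    using rst iso by (intro ex1I[of _ "(s, t)"]) auto
next
  show "L_in A = {(\<lambda>n. (\<one> \<oplus> r \<otimes> x) \<otimes> n) ` path_module s t | r s t. r \<in> R \<and> s \<in> S \<and> t \<le> N - 1}"
  proof (intro equalityI subsetI)
    fix I assume "I \<in> L_in A"
    then show "I \<in> {(\<lambda>n. (\<one> \<oplus> r \<otimes> x) \<otimes> n) ` path_module s t | r s t. r \<in> R \<and> s \<in> S \<and> t \<le> N - 1}"
      using indecomposable_is_translate[of I] unfolding L_in_def by blast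
  next
    fix I assume "I \<in> {(\<lambda>n. (\<one> \<oplus> r \<otimes> x) \<otimes> n) ` path_module s t | r s t. r \<in> R \<and> s \<in> S \<and> t \<le> N - 1}"
    then obtain r s t where rst: "r \<in> R" "s \<in> S" "t \<le> N - 1"
        "I = (\<lambda>n. (\<one> \<oplus> r \<otimes> x) \<otimes> n) ` path_module s t" by blast
    obtain g where "g \<in> R" "g \<otimes> (\<one> \<oplus> r \<otimes> x) = \<one>"
      using one_plus_inverse[OF rst(1)] by metis
    then show "I \<in> L_in A"
      using translate_path_module_indecomposable[of "\<one> \<oplus> r \<otimes> x" g s t] rst by (simp add: L_in_def)
  qed
qed

end

section \<open>An action of the free algebra on functions\<close>

text \<open>The pair \<open>(m, v)\<close> is a vertex \<open>v\<close> together with the number \<open>m\<close> of steps that remain to be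
taken from it: \<open>x\<close> takes one step along \<open>\<omega>\<close>, and \<open>e\<^sub>s\<close> tests the current vertex.  Acting on
functions of \<open>(m, v)\<close>, rather than on a basis, makes the product of the free algebra correspond
to plain composition, without a sum over intermediate pairs.\<close>

fun letter_act :: "('s \<Rightarrow> 's) \<Rightarrow> 's kgen \<Rightarrow> (nat \<Rightarrow> 's \<Rightarrow> 'k) \<Rightarrow> nat \<Rightarrow> 's \<Rightarrow> 'k::field" where
  "letter_act \<omega> (Gen_e s) f m v = (if v = s then f m v else 0)"
| "letter_act \<omega> Gen_x f m v = (case m of 0 \<Rightarrow> 0 | Suc n \<Rightarrow> f n (\<omega> v))"

definition word_act ::
    "('s \<Rightarrow> 's) \<Rightarrow> 's kgen fword \<Rightarrow> (nat \<Rightarrow> 's \<Rightarrow> 'k) \<Rightarrow> nat \<Rightarrow> 's \<Rightarrow> 'k::field" where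
  "word_act \<omega> w = foldr (letter_act \<omega>) (letters w)"

definition act ::
    "('s \<Rightarrow> 's) \<Rightarrow> ('s kgen fword \<Rightarrow>\<^sub>0 'k) \<Rightarrow> (nat \<Rightarrow> 's \<Rightarrow> 'k) \<Rightarrow> nat \<Rightarrow> 's \<Rightarrow> 'k::field" where
  "act \<omega> p f m v =
     (\<Sum>w\<in>Poly_Mapping.keys p. Poly_Mapping.lookup p w * word_act \<omega> w f m v)"

lemma letter_act_add:
  "letter_act \<omega> g (\<lambda>m v. f m v + f' m v) = (\<lambda>m v. letter_act \<omega> g f m v + letter_act \<omega> g f' m v)"
  by (cases g) (auto simp: fun_eq_iff split: nat.split)

lemma letter_act_scale:
  "letter_act \<omega> g (\<lambda>m v. c * f m v) = (\<lambda>m v. c * letter_act \<omega> g f m v)"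
  by (cases g) (auto simp: fun_eq_iff split: nat.split)

lemma foldr_letter_act_add:
  "foldr (letter_act \<omega>) gs (\<lambda>m v. f m v + f' m v) =
     (\<lambda>m v. foldr (letter_act \<omega>) gs f m v + foldr (letter_act \<omega>) gs f' m v)"
  by (induction gs) (simp_all add: letter_act_add)

lemma foldr_letter_act_scale:
  "foldr (letter_act \<omega>) gs (\<lambda>m v. c * f m v) = (\<lambda>m v. c * foldr (letter_act \<omega>) gs f m v)"
  by (induction gs) (simp_all add: letter_act_scale)

lemma act_superset:
  assumes "finite F" "Poly_Mapping.keys p \<subseteq> F"
  shows "act \<omega> p f m v = (\<Sum>w\<in>F. Poly_Mapping.lookup p w * word_act \<omega> w f m v)"
  unfolding act_def
  by (rule sum.mono_neutral_left) (use assms in \<open>auto simp: in_keys_iff\<close>)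

lemma act_add: "act \<omega> (p + q) f = (\<lambda>m v. act \<omega> p f m v + act \<omega> q f m v)"
proof (intro ext)
  fix m v
  let ?F = "Poly_Mapping.keys p \<union> Poly_Mapping.keys q"
  have "act \<omega> (p + q) f m v = (\<Sum>w\<in>?F. Poly_Mapping.lookup (p + q) w * word_act \<omega> w f m v)"
    by (rule act_superset) (simp_all add: Poly_Mapping.keys_add)
  then show "act \<omega> (p + q) f m v = act \<omega> p f m v + act \<omega> q f m v"
    by (simp add: act_superset[of ?F p] act_superset[of ?F q] lookup_add distrib_right sum.distrib)
qed

lemma act_single: "act \<omega> (Poly_Mapping.single w c) f = (\<lambda>m v. c * word_act \<omega> w f m v)"
  by (intro ext) (simp add: act_superset[of "{w}"])

lemma act_zero: "act \<omega> 0 f = (\<lambda>m v. 0)"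
  by (simp add: act_def fun_eq_iff)

lemma act_uminus: "act \<omega> (- p) f m v = - act \<omega> p f m v"
  by (simp add: act_def sum_negf)

lemma act_diff: "act \<omega> (p - q) f m v = act \<omega> p f m v - act \<omega> q f m v"
  using act_add[of \<omega> p "- q" f] by (simp add: act_uminus)

lemma act_sum: "act \<omega> (sum p I) f m v = (\<Sum>i\<in>I. act \<omega> (p i) f m v)"
  by (induction I rule: infinite_finite_induct) (simp_all add: act_zero act_add)

lemma act_one: "act \<omega> 1 f = f"
  using act_single[of \<omega> 0 1 f] by (simp add: word_act_def)

lemma act_fgen: "act \<omega> (fgen g) f = letter_act \<omega> g f"
  by (simp add: fgen_def act_single word_act_def)

lemma poly_mapping_add_single_induct [case_names zero add_single]:
  assumes "P 0" and "\<And>p w c. w \<notin> Poly_Mapping.keys p \<Longrightarrow> c \<noteq> 0 \<Longrightarrow> P p \<Longrightarrow> P (p + Poly_Mapping.single w c)"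
  shows "P p"
proof (induction p rule: Poly_Mapping.update_induct)
  case (update p w c)
  then have "Poly_Mapping.update w c p = p + Poly_Mapping.single w c"
    by (intro poly_mapping_eqI)
       (auto simp: lookup_update lookup_add lookup_single when_def in_keys_iff)
  then show ?case using update assms by simp
qed (rule assms(1))

lemma act_mult: "act \<omega> (p * q) f = act \<omega> p (act \<omega> q f)"
proof (induction p rule: poly_mapping_add_single_induct)
  case (add_single p w c)
  have "act \<omega> (Poly_Mapping.single w c * q) f = act \<omega> (Poly_Mapping.single w c) (act \<omega> q f)"
  proof (induction q rule: poly_mapping_add_single_induct)
    case zero
    have "foldr (letter_act \<omega>) (letters w) (\<lambda>m v. 0) = (\<lambda>m v. 0 :: 'b)"
      using foldr_letter_act_scale[of \<omega> "letters w" 0] by simp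
    then show ?case
      by (simp only: mult_zero_right act_zero act_single word_act_def)
  next
    case (add_single q u d)
    then show ?case
      by (simp add: distrib_left act_add act_single mult_single word_act_def foldr_letter_act_add
          foldr_letter_act_scale mult.assoc)
  qed
  with add_single show ?case by (simp add: distrib_right act_add)
qed (simp add: act_zero fun_eq_iff)

text \<open>Only the values at pairs with \<open>m < N\<close> and \<open>v \<in> S\<close> matter: no generator leads out of
this region, because \<open>\<omega>\<close> preserves \<open>S\<close> and the number of steps never grows.\<close>

lemma act_local:
  assumes "\<omega> permutes S" and "\<And>m v. m < N \<Longrightarrow> v \<in> S \<Longrightarrow> f m v = 0" and "m < N" "v \<in> S"
  shows "act \<omega> p f m v = 0"
proof -
  have "foldr (letter_act \<omega>) gs f m v = 0" if "m < N" "v \<in> S" for gs m v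
    using that
  proof (induction gs arbitrary: m v)
    case (Cons g gs)
    then show ?case
      using permutes_in_image[OF assms(1)] by (cases g) (auto split: nat.split)
  qed (simp add: assms(2))
  then show ?thesis using assms by (simp add: act_def word_act_def)
qed

lemma act_x_pow:
  "act \<omega> (fgen Gen_x ^ n) f m v = (if n \<le> m then f (m - n) ((\<omega> ^^ n) v) else 0)"
proof (induction n arbitrary: m v)
  case (Suc n)
  then show ?case by (auto simp: act_mult act_fgen funpow_swap1 split: nat.split)
qed (simp add: act_one)

text \<open>The elements that send every function to one vanishing for \<open>m < N\<close> and \<open>v \<in> S\<close> form an
ideal containing the relations.  The bound \<open>m < N\<close> is what makes \<open>x\<^sup>N\<close> act as zero, and
\<open>v \<in> S\<close> is what makes \<open>\<Sum> e\<^sub>s\<close> act as the identity.\<close>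

lemma kw_ideal_acts_zero:
  assumes "finite S" "\<omega> permutes S" and p: "p \<in> kw_ideal S \<omega> N" and m: "m < N" "v \<in> S"
  shows "act \<omega> p f m v = (0 :: 'k::field)"
proof -
  let ?F = "free_alg (kw_gens S) :: ('a kgen fword \<Rightarrow>\<^sub>0 'k) ring"
  define K where "K = {p \<in> carrier ?F. \<forall>f. \<forall>m<N. \<forall>v\<in>S. act \<omega> p f m v = 0}"
  interpret F: ring ?F by (rule free_alg_ring)
  have "ideal K ?F"
  proof (rule idealI)
    show "subgroup K (add_monoid ?F)"
    proof (rule F.add.subgroupI)
      fix p assume p: "p \<in> K"
      then have "\<ominus>\<^bsub>?F\<^esub> p = - p"
        by (intro F.minus_equality) (auto simp: K_def free_alg_uminus)
      with p show "\<ominus>\<^bsub>?F\<^esub> p \<in> K"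
        by (auto simp: K_def free_alg_uminus act_uminus)
    next
      have "0 \<in> K" by (simp add: K_def free_alg_zero act_zero)
      then show "K \<noteq> {}" by blast
    qed (auto simp: K_def free_alg_add act_add)
  next
    fix p q assume "p \<in> K" "q \<in> carrier ?F"
    then show "q \<otimes>\<^bsub>?F\<^esub> p \<in> K" "p \<otimes>\<^bsub>?F\<^esub> q \<in> K"
      using act_local[OF assms(2), of N "act \<omega> p f" for f]
      by (auto simp: K_def free_alg_mult act_mult)
  qed (rule free_alg_ring)
  moreover have "kw_rels S \<omega> N \<subseteq> K"
  proof
    fix p :: "'a kgen fword \<Rightarrow>\<^sub>0 'k" assume p: "p \<in> kw_rels S \<omega> N"
    have "p \<in> carrier ?F"
      using kw_rels_carrier[of S \<omega> N] permutes_in_image[OF assms(2)] p by blast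
    moreover have "act \<omega> p f m v = 0" if "m < N" "v \<in> S" for f m v
      using p that assms(1) permutes_inj[OF assms(2), THEN injD]
      unfolding kw_rels_def
      by (auto simp: act_diff act_mult act_fgen act_one act_sum act_zero act_x_pow
          split: nat.split if_splits)
    ultimately show "p \<in> K" by (simp add: K_def)
  qed
  ultimately have "kw_ideal S \<omega> N \<subseteq> K"
    unfolding kw_ideal_def by (rule F.genideal_minimal)
  then show ?thesis using p m by (auto simp: K_def)
qed

section \<open>The presented algebra\<close>

lemma fconst_central: "fconst c * p = p * fconst c"
proof (induction p rule: poly_mapping_add_single_induct)
  case (add_single p w d)
  then show ?case
    by (simp add: distrib_left distrib_right fconst_def mult_single mult.commute)
qed simp

text \<open>All conditions but one are transported from the free algebra along the quotient map.  The
nonvanishing of \<open>e\<^sub>s x\<^bsup>N-1\<^esup>\<close> holds because this element sends the constant function \<open>1\<close> to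
one with value \<open>1\<close> at \<open>(N - 1, s)\<close>.\<close>

lemma kw_alg_permutation_algebra:
  fixes S :: "'s set" and \<omega> :: "'s \<Rightarrow> 's" and N :: nat
  assumes N: "N \<ge> 1" and S: "finite S" and \<omega>: "\<omega> permutes S"
  shows "permutation_algebra (kw_alg S \<omega> N :: ('s kgen fword \<Rightarrow>\<^sub>0 'k::field) set ring)
    (\<lambda>c. kw_class S \<omega> N (fconst c)) S \<omega> N (kw_e S \<omega> N) (kw_x S \<omega> N)"
proof -
  let ?F = "free_alg (kw_gens S) :: ('s kgen fword \<Rightarrow>\<^sub>0 'k) ring"
  define A where "A = (kw_alg S \<omega> N :: ('s kgen fword \<Rightarrow>\<^sub>0 'k) set ring)"
  define cl where "cl = (kw_class S \<omega> N :: ('s kgen fword \<Rightarrow>\<^sub>0 'k) \<Rightarrow> _)"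
  interpret F: ring ?F by (rule free_alg_ring)
  interpret I: ideal "kw_ideal S \<omega> N" ?F by (rule kw_ideal_ideal[OF \<omega>])
  interpret A: ring A unfolding A_def by (rule kw_alg_ring[OF \<omega>])
  have hom: "cl \<in> ring_hom ?F A"
    using I.rcos_ring_hom unfolding A_def cl_def kw_alg_def kw_class_def .
  have cl_closed: "p \<in> carrier ?F \<Longrightarrow> cl p \<in> carrier A" for p
    using ring_hom_closed[OF hom] .
  have cl_add: "p \<in> carrier ?F \<Longrightarrow> q \<in> carrier ?F \<Longrightarrow> cl (p + q) = cl p \<oplus>\<^bsub>A\<^esub> cl q" for p q
    using ring_hom_add[OF hom] by simp
  have cl_mult: "p \<in> carrier ?F \<Longrightarrow> q \<in> carrier ?F \<Longrightarrow> cl (p * q) = cl p \<otimes>\<^bsub>A\<^esub> cl q" for p q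
    using ring_hom_mult[OF hom] by simp
  have cl_one: "cl 1 = \<one>\<^bsub>A\<^esub>"
    using ring_hom_one[OF hom] by simp
  have cl_zero: "cl 0 = \<zero>\<^bsub>A\<^esub>"
    using cl_add[of 0 0] cl_closed[of 0] by (simp add: free_alg_zero A.add.l_cancel_one)
  have cl_zero_iff: "cl p = \<zero>\<^bsub>A\<^esub> \<longleftrightarrow> p \<in> kw_ideal S \<omega> N" if "p \<in> carrier ?F" for p
  proof -
    have "\<zero>\<^bsub>A\<^esub> = kw_ideal S \<omega> N" by (simp add: A_def kw_alg_def FactRing_def)
    then show ?thesis
      using I.rcos_const_imp_mem[OF that] F.a_rcos_zero[OF I.ideal_axioms]
      unfolding cl_def kw_class_def by auto
  qed
  have cl_pow: "cl (p ^ n) = cl p [^]\<^bsub>A\<^esub> n" if "p \<in> carrier ?F" for p and n :: nat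
  proof (induction n)
    case (Suc n)
    then show ?case
      using that by (simp add: power_Suc2 cl_mult free_alg_power del: power_Suc)
  qed (simp add: cl_one)
  have rel: "cl p = cl q" if "p - q \<in> kw_rels S \<omega> N" "q \<in> carrier ?F" for p q
  proof -
    have c: "p - q \<in> carrier ?F"
      using kw_rels_carrier[of S \<omega> N] permutes_in_image[OF \<omega>] that by blast
    have "p - q \<in> kw_ideal S \<omega> N"
      using F.genideal_self[of "kw_rels S \<omega> N"] kw_rels_carrier[of S \<omega> N] permutes_in_image[OF \<omega>] that
      unfolding kw_ideal_def by blast
    then have "cl (p - q) = \<zero>\<^bsub>A\<^esub>" using cl_zero_iff c by simp
    then show ?thesis using cl_add[OF c that(2)] cl_closed that(2) by simp
  qed
  have e_F: "fgen (Gen_e s) \<in> carrier ?F" if "s \<in> S" for s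
    using that by (intro free_alg_gen) (simp add: kw_gens_def)
  have x_F: "fgen Gen_x \<in> carrier ?F"
    by (intro free_alg_gen) (simp add: kw_gens_def)
  have e_def: "kw_e S \<omega> N = (\<lambda>s. cl (fgen (Gen_e s)))" and x_def: "kw_x S \<omega> N = cl (fgen Gen_x)"
    by (simp_all add: kw_e_def kw_x_def cl_def fun_eq_iff)
  have "permutation_algebra A (\<lambda>c. cl (fconst c)) S \<omega> N (kw_e S \<omega> N) (kw_x S \<omega> N)"
    unfolding e_def x_def
  proof (intro permutation_algebra.intro permutation_algebra_axioms.intro)
    show "ring A" by (rule A.ring_axioms)
    show "cl (fconst c) \<in> carrier A" for c
      by (intro cl_closed free_alg_const)
    show "cl (fconst (c + d)) = cl (fconst c) \<oplus>\<^bsub>A\<^esub> cl (fconst d)" for c d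
      by (simp add: cl_add[symmetric] free_alg_const) (simp add: fconst_def single_add)
    show "cl (fconst (c * d)) = cl (fconst c) \<otimes>\<^bsub>A\<^esub> cl (fconst d)" for c d
      by (simp add: cl_mult[symmetric] free_alg_const) (simp add: fconst_def mult_single)
    show "cl (fconst 1) = \<one>\<^bsub>A\<^esub>" by (simp add: fconst_one cl_one)
    have surj: "\<exists>p\<in>carrier ?F. a = cl p" if "a \<in> carrier A" for a
      using that unfolding A_def cl_def kw_alg_def kw_class_def FactRing_simps by auto
    show "cl (fconst c) \<otimes>\<^bsub>A\<^esub> a = a \<otimes>\<^bsub>A\<^esub> cl (fconst c)" if a: "a \<in> carrier A" for a c
    proof -
      obtain p where "p \<in> carrier ?F" "a = cl p" using surj[OF a] by blast
      then show ?thesis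
        by (simp add: cl_mult[symmetric] free_alg_const fconst_central)
    qed
    show "finite S" "\<omega> permutes S" "1 \<le> N" by fact+
    show "cl (fgen (Gen_e s)) \<in> carrier A" if "s \<in> S" for s
      using that by (intro cl_closed e_F)
    show "cl (fgen Gen_x) \<in> carrier A" by (intro cl_closed x_F)
    show "cl (fgen (Gen_e s)) \<otimes>\<^bsub>A\<^esub> cl (fgen (Gen_e t)) = (if s = t then cl (fgen (Gen_e t)) else \<zero>\<^bsub>A\<^esub>)"
      if "s \<in> S" "t \<in> S" for s t
    proof -
      have "cl (fgen (Gen_e s) * fgen (Gen_e t)) = cl (if s = t then fgen (Gen_e t) else 0)"
        by (rule rel) (use that e_F in \<open>auto simp: kw_rels_def free_alg_zero\<close>)
      then show ?thesis using that by (auto simp: cl_mult e_F cl_zero)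
    qed
    show "(\<Oplus>\<^bsub>A\<^esub>s\<in>S. cl (fgen (Gen_e s))) = \<one>\<^bsub>A\<^esub>"
    proof -
      have "cl (\<Sum>s\<in>T. fgen (Gen_e s)) = (\<Oplus>\<^bsub>A\<^esub>s\<in>T. cl (fgen (Gen_e s)))" if "T \<subseteq> S" for T
        using finite_subset[OF that S] that
      proof (induction T rule: finite_induct)
        case (insert t T)
        then have "(\<Sum>s\<in>T. fgen (Gen_e s)) \<in> carrier ?F" "t \<in> S"
          by (auto intro!: free_alg_sum e_F)
        then show ?case
          using insert by (subst A.finsum_insert) (auto simp: cl_add e_F intro!: cl_closed e_F)
      qed (simp add: cl_zero)
      moreover have "cl 1 = cl (\<Sum>s\<in>S. fgen (Gen_e s))"
        by (rule rel) (auto simp: kw_rels_def intro!: free_alg_sum e_F)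
      ultimately show ?thesis by (simp add: cl_one)
    qed
    show "cl (fgen Gen_x) [^]\<^bsub>A\<^esub> N = \<zero>\<^bsub>A\<^esub>"
      using rel[of "fgen Gen_x ^ N" 0] by (simp add: kw_rels_def free_alg_zero cl_pow x_F cl_zero)
    show "cl (fgen (Gen_e s)) \<otimes>\<^bsub>A\<^esub> cl (fgen Gen_x) = cl (fgen Gen_x) \<otimes>\<^bsub>A\<^esub> cl (fgen (Gen_e (\<omega> s)))"
      if "s \<in> S" for s
    proof -
      have \<omega>s: "\<omega> s \<in> S" using that permutes_in_image[OF \<omega>] by simp
      have "cl (fgen (Gen_e s) * fgen Gen_x) = cl (fgen Gen_x * fgen (Gen_e (\<omega> s)))"
        by (rule rel) (use that \<omega>s x_F e_F in \<open>auto simp: kw_rels_def intro!: free_alg_mult\<close>)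
      then show ?thesis using that \<omega>s by (simp add: cl_mult e_F x_F)
    qed
    let ?H = "range (\<lambda>c. cl (fconst c)) \<union> {cl (fgen Gen_x)} \<union> (\<lambda>s. cl (fgen (Gen_e s))) ` S"
    have H: "?H \<subseteq> carrier A"
      by (auto intro!: cl_closed free_alg_const x_F e_F)
    have word: "cl (Poly_Mapping.single (FWord gs) c) \<in> generate_ring A ?H" if "set gs \<subseteq> kw_gens S" for gs c
      using that
    proof (induction gs)
      case Nil
      have "cl (fconst c) \<in> generate_ring A ?H" by (intro generate_ring.incl) auto
      then show ?case by (simp add: fconst_def zero_fword_def)
    next
      case (Cons g gs)
      have "Poly_Mapping.single (FWord (g # gs)) c = fgen g * Poly_Mapping.single (FWord gs) c"
        by (simp add: fgen_def mult_single plus_fword_def)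
      moreover have "cl (fgen g) \<in> generate_ring A ?H"
        using Cons.prems by (intro generate_ring.incl) (auto simp: kw_gens_def)
      moreover have "fgen g \<in> carrier ?F" "Poly_Mapping.single (FWord gs) c \<in> carrier ?F"
        using Cons.prems free_alg_gen[of g] by (auto simp: free_alg_carrier_iff[of "Poly_Mapping.single _ _"])
      ultimately show ?case
        using Cons by (simp add: cl_mult generate_ring.eng_mult)
    qed
    have all: "p \<in> carrier ?F \<longrightarrow> cl p \<in> generate_ring A ?H" for p
    proof (induction p rule: poly_mapping_add_single_induct)
      case zero
      show ?case using A.zero_in_generate by (simp add: cl_zero)
    next
      case (add_single p w c)
      show ?case
      proof
        assume *: "p + Poly_Mapping.single w c \<in> carrier ?F"
        have keys: "Poly_Mapping.keys (p + Poly_Mapping.single w c) = insert w (Poly_Mapping.keys p)"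
          using add_single by (auto simp: in_keys_iff lookup_add lookup_single when_def split: if_splits)
        have p: "p \<in> carrier ?F" and w: "set (letters w) \<subseteq> kw_gens S"
          using * unfolding free_alg_carrier_iff keys by auto
        then have "Poly_Mapping.single w c \<in> carrier ?F"
          by (auto simp: free_alg_carrier_iff)
        moreover have "cl (Poly_Mapping.single w c) \<in> generate_ring A ?H"
          using word[OF w, of c] by simp
        ultimately show "cl (p + Poly_Mapping.single w c) \<in> generate_ring A ?H"
          using p add_single by (simp add: cl_add generate_ring.eng_add)
      qed
    qed
    show "generate_ring A ?H = carrier A"
      using A.generate_ring_incl[OF H] surj all by blast
    show "cl (fgen (Gen_e s)) \<otimes>\<^bsub>A\<^esub> cl (fgen Gen_x) [^]\<^bsub>A\<^esub> (N - 1) \<noteq> \<zero>\<^bsub>A\<^esub>" if "s \<in> S" for s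
    proof
      let ?p = "fgen (Gen_e s) * fgen Gen_x ^ (N - 1) :: 's kgen fword \<Rightarrow>\<^sub>0 'k"
      assume "cl (fgen (Gen_e s)) \<otimes>\<^bsub>A\<^esub> cl (fgen Gen_x) [^]\<^bsub>A\<^esub> (N - 1) = \<zero>\<^bsub>A\<^esub>"
      then have "cl ?p = \<zero>\<^bsub>A\<^esub>"
        using that by (simp add: cl_mult e_F x_F free_alg_power cl_pow)
      then have "?p \<in> kw_ideal S \<omega> N"
        using cl_zero_iff that by (simp add: free_alg_mult e_F x_F free_alg_power)
      then have "act \<omega> ?p (\<lambda>_ _. 1) (N - 1) s = 0"
        by (rule kw_ideal_acts_zero[OF S \<omega>]) (use that N in auto)
      then show False by (simp add: act_mult act_fgen act_x_pow)
    qed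
  qed
  then show ?thesis by (simp add: A_def cl_def)
qed

theorem theorem12:
  fixes S :: "'s set" and \<omega> :: "'s \<Rightarrow> 's" and N :: nat
    and A :: "('s kgen fword \<Rightarrow>\<^sub>0 'k::field) set ring"
  assumes "N \<ge> 2" and "finite S" and "card S \<ge> N" and "\<omega> permutes S"
  defines "A \<equiv> kw_alg S \<omega> N"
    and "e \<equiv> kw_e S \<omega> N"
    and "x \<equiv> kw_x S \<omega> N"
    and "R \<equiv> kw_R S \<omega> N"
  defines "Nst \<equiv> (\<lambda>(s :: 's) (t :: nat). {e s \<otimes>\<^bsub>A\<^esub> x [^]\<^bsub>A\<^esub> t \<otimes>\<^bsub>A\<^esub> r | r. r \<in> R})"
  shows "(\<forall>s\<in>S. \<forall>t\<le>N - 1. Nst s t \<in> L_in A) \<and>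
         (\<forall>I\<in>L_in A. \<exists>!(s, t). s \<in> S \<and> t \<le> N - 1 \<and> right_module_isomorphic A I (Nst s t)) \<and>
         L_in A = {(\<lambda>n. (\<one>\<^bsub>A\<^esub> \<oplus>\<^bsub>A\<^esub> r \<otimes>\<^bsub>A\<^esub> x) \<otimes>\<^bsub>A\<^esub> n) ` Nst s t | r s t. r \<in> R \<and> s \<in> S \<and> t \<le> N - 1}"
proof -
  interpret P: permutation_algebra A "\<lambda>c. kw_class S \<omega> N (fconst c)" S \<omega> N e x
    unfolding A_def e_def x_def
    using assms(1,2,4) by (intro kw_alg_permutation_algebra) auto
  have R: "P.R = R"
    unfolding P.R_def unfolding R_def kw_R_def kw_scalars_def A_def x_def ..
  have Nst: "P.path_module = Nst"
    by (simp add: P.path_module_def Nst_def R fun_eq_iff)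
  show ?thesis
    using P.indecomposable_right_ideals unfolding R Nst .
qed

end
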